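(* Let $1\le p\le\infty$, $\beta\in\mathbb{R}$, $r>1$ and $n\in\mathbb{N}$ satisfy $$\sqrt{n}+1\le r\le n+1 .$$ Then for $p=1$ $$\mathcal{E}_n(W^r_{\beta,1})_C=n^{-r}\Big(\frac{1}{\pi(1-e^{-r/n})}+O(1)\,n\,r^{-2}\Big),$$ and for $1<p\le\infty$ $$\mathcal{E}_n(W^r_{\beta,p})_C=n^{-r}\Big(\frac{\|\cos t\|_{p'}}{\pi}\,F^{\frac1{p'}}\Big(\frac{p'}{2},\frac{p'}{2};1;e^{-2r/n}\Big)+O(1)\,n\,r^{-2}\Big),\qquad \frac1p+\frac1{p'}=1,$$ where the quantities $O(1)$ are uniformly bounded with respect to all parameters considered, i.e. bounded in absolute value by an absolute constant independent of $p,\beta,r,n$.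
   Context: $L_p$, $1\le p<\infty$, is the space of $2\pi$-periodic functions $\varphi$ with $\|\varphi\|_p=\big(\int_{-\pi}^{\pi}|\varphi(t)|^p\,dt\big)^{1/p}<\infty$; $L_\infty$ is the space of $2\pi$-periodic measurable essentially bounded functions with $\|\varphi\|_\infty=\operatorname{ess\,sup}_t|\varphi(t)|$; $C$ is the space of $2\pi$-periodic continuous functions with $\|\varphi\|_C=\max_t|\varphi(t)|$. For $1\le p\le\infty$ let $B_p^0=\{\varphi\in L_p:\ \|\varphi\|_p\le 1,\ \int_{-\pi}^{\pi}\varphi(t)\,dt=0\}$. For $r>0$, $\beta\in\mathbb{R}$, the Weyl--Nagy class $W^r_{\beta,p}$ is the set of all $2\pi$-periodic functions $f$ of the form $$f(x)=\frac{a_0}{2}+\frac1\pi\int_{-\pi}^{\pi}\varphi(x-t)B_{r,\beta}(t)\,dt,\quad a_0\in\mathbb{R},\ \varphi\in B_p^0,\qquad B_{r,\beta}(t)=\sum_{k=1}^\infty k^{-r}\cos\Big(kt-\frac{\beta\pi}{2}\Big).$$ For a set $\mathfrak{N}\subset X$, where $X=C$ or $X=L_s$, $1\le s\le\infty$, put $$\mathcal{E}_n(\mathfrak{N})_X=\sup_{f\in\mathfrak{N}}\|f(\cdot)-S_{n-1}(f;\cdot)\|_X,$$ where $S_{n-1}(f;\cdot)$ is the partial Fourier sum of $f$ of order $n-1$ (harmonics $0,1,\dots,n-1$). $F(a,b;c;z)=1+\sum_{k=1}^\infty\frac{(a)_k(b)_k}{(c)_k}\frac{z^k}{k!}$, with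 $(x)_k=x(x+1)\cdots(x+k-1)$, is the Gauss hypergeometric function; $F^{1/s}(\cdot)$ denotes its value raised to the power $1/s$. For $p=\infty$ one has $p'=1$. *)

theory Defs
  imports "HOL-Probability.Probability"
begin

definition periodic_2pi :: "(real \<Rightarrow> real) \<Rightarrow> bool" where
  "periodic_2pi f \<longleftrightarrow> (\<forall>x. f (x + 2 * pi) = f x)"

text \<open>
  The exponent ranges over the extended reals \<open>1 \<le> p \<le> \<infinity>\<close>. All norms are extended-real valued
  (a function outside the space in question may have norm \<open>\<infinity>\<close>), so that suprema of norms need no
  boundedness side conditions. The integral is not normalised.
\<close>

definition Lp_norm :: "ereal \<Rightarrow> (real \<Rightarrow> real) \<Rightarrow> ereal" where
  "Lp_norm p f =
     (if p = \<infinity> then esssup (lebesgue_on {-pi..pi}) (\<lambda>t. ereal \<bar>f t\<bar>)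
      else (let I = (\<integral>\<^sup>+ t. ennreal (\<bar>f t\<bar> powr real_of_ereal p) \<partial>lebesgue_on {-pi..pi})
            in if I = \<infinity> then \<infinity> else ereal (enn2real I powr (1 / real_of_ereal p))))"

definition Lp_space :: "ereal \<Rightarrow> (real \<Rightarrow> real) set" where
  "Lp_space p = {f. periodic_2pi f \<and> f \<in> borel_measurable lebesgue \<and> Lp_norm p f < \<infinity>}"

text \<open>For continuous periodic functions the supremum below is the maximum.\<close>

definition C_norm :: "(real \<Rightarrow> real) \<Rightarrow> ereal" where
  "C_norm f = (SUP t. ereal \<bar>f t\<bar>)"

definition Bp0 :: "ereal \<Rightarrow> (real \<Rightarrow> real) set" where
  "Bp0 p = {\<phi> \<in> Lp_space p. Lp_norm p \<phi> \<le> 1 \<and> (LINT t:{-pi..pi}|lebesgue. \<phi> t) = 0}"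

definition weyl_nagy_kernel :: "real \<Rightarrow> real \<Rightarrow> real \<Rightarrow> real" where
  "weyl_nagy_kernel r \<beta> t =
     (\<Sum>k. real (Suc k) powr (-r) * cos (real (Suc k) * t - \<beta> * pi / 2))"

text \<open>
  The representation is required at every point \<open>x\<close>; for \<open>r > 1\<close> the kernel is continuous, so the
  convolution exists everywhere and the members of the class are continuous functions.
\<close>

definition weyl_nagy_class :: "real \<Rightarrow> real \<Rightarrow> ereal \<Rightarrow> (real \<Rightarrow> real) set" where
  "weyl_nagy_class r \<beta> p =
     {f. periodic_2pi f \<and>
         (\<exists>a0. \<exists>\<phi> \<in> Bp0 p. \<forall>x.
            f x = a0 / 2 +
              1 / pi * (LINT t:{-pi..pi}|lebesgue. \<phi> (x - t) * weyl_nagy_kernel r \<beta> t))}"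

definition fourier_cos_coeff :: "(real \<Rightarrow> real) \<Rightarrow> nat \<Rightarrow> real" where
  "fourier_cos_coeff f k = 1 / pi * (LINT t:{-pi..pi}|lebesgue. f t * cos (real k * t))"

definition fourier_sin_coeff :: "(real \<Rightarrow> real) \<Rightarrow> nat \<Rightarrow> real" where
  "fourier_sin_coeff f k = 1 / pi * (LINT t:{-pi..pi}|lebesgue. f t * sin (real k * t))"

definition fourier_sum :: "nat \<Rightarrow> (real \<Rightarrow> real) \<Rightarrow> real \<Rightarrow> real" where
  "fourier_sum m f x = fourier_cos_coeff f 0 / 2 +
     (\<Sum>k=1..m. fourier_cos_coeff f k * cos (real k * x) + fourier_sin_coeff f k * sin (real k * x))"

text \<open>
  The first argument is the norm of the space \<open>X\<close>, e.g. \<^const>\<open>C_norm\<close> or \<open>Lp_norm s\<close>; the order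
  \<open>n\<close> is meant to be positive.
\<close>

definition fourier_approx ::
    "((real \<Rightarrow> real) \<Rightarrow> ereal) \<Rightarrow> nat \<Rightarrow> (real \<Rightarrow> real) set \<Rightarrow> ereal" where
  "fourier_approx N n A = (SUP f\<in>A. N (\<lambda>x. f x - fourier_sum (n - 1) f x))"

definition hypergeo_2F1 :: "real \<Rightarrow> real \<Rightarrow> real \<Rightarrow> real \<Rightarrow> real" where
  "hypergeo_2F1 a b c z =
     1 + (\<Sum>k. pochhammer a (Suc k) * pochhammer b (Suc k) / pochhammer c (Suc k)
               * (z ^ Suc k / fact (Suc k)))"

end

theory Submission imports Defs begin

text \<open>Put \<open>\<rho> = e\<^bsup>-r/n\<^esup>\<close> and \<open>\<gamma> = \<beta> \<pi> / 2\<close>. The remainder \<open>f - S\<^bsub>n-1\<^esub> f\<close> is the convolution of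
  \<open>\<phi>\<close> with \<open>n\<^bsup>-r\<^esup> D / \<pi>\<close>, where \<open>D(t) = \<Sum>\<^sub>k (1 + k/n)\<^bsup>-r\<^esup> cos ((n + k) t - \<gamma>)\<close>. Replacing
  \<open>(1 + k/n)\<^bsup>-r\<^esup>\<close> by \<open>\<rho>\<^bsup>k\<^esup>\<close> costs \<open>O(n/r\<^sup>2)\<close> uniformly in \<open>t\<close> and turns \<open>D\<close> into
  \<open>P\<^sub>\<gamma>(t) = F(t, n t - \<gamma>)\<close> with \<open>F(t, s) = Re (e\<^bsup>is\<^esup> / (1 - \<rho> e\<^bsup>it\<^esup>))\<close>. As \<open>F\<close> is Lipschitz in \<open>t\<close> with
  constant \<open>(1 - \<rho>)\<^bsup>-2\<^esup> = O(n\<^sup>2/r\<^sup>2)\<close>, a shift of \<open>t\<close> by \<open>v/n\<close> changes the phase \<open>\<gamma>\<close> by \<open>v\<close> up to an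
  error \<open>O(n/r\<^sup>2)\<close>.

  Hence the norms \<open>\<parallel>P\<^sub>\<gamma>\<parallel>\<^sub>q\<close> for different \<open>\<gamma>\<close> agree up to \<open>O(n/r\<^sup>2)\<close>, and the mean of
  \<open>\<parallel>P\<^sub>\<gamma>\<parallel>\<^sub>q\<^bsup>q\<^esup>\<close> over \<open>\<gamma>\<close> is, by Fubini, a product of the integrals of \<open>\<bar>cos\<bar>\<^bsup>q\<^esup>\<close> and
  \<open>\<bar>1 - \<rho> e\<^bsup>it\<^esup>\<bar>\<^bsup>-q\<^esup>\<close>; the latter is hypergeometric by Parseval's identity. Hoelder's inequality
  gives the upper bound. For the lower bound take an extremal \<open>\<psi>\<close> for \<open>D\<close>: since
  \<open>D(t - \<pi>/n) = - D(t) + O(n/r\<^sup>2)\<close>, the function \<open>(\<psi>(t) - \<psi>(t + \<pi>/n)) / 2\<close> has mean zero and is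
  nearly extremal. All estimates are uniform in \<open>q\<close>.\<close>

section \<open>Lebesgue measure on one period\<close>

abbreviation circ :: "real measure" where
  "circ \<equiv> lebesgue_on {-pi..pi}"

lemma set_LINT_circ: "(LINT t:{-pi..pi}|lebesgue. f t) = (\<integral>t. f t \<partial>circ)" for f :: "real \<Rightarrow> real"
  by (simp add: set_lebesgue_integral_def integral_restrict_space)

lemma measure_circ [simp]: "measure circ {-pi..pi} = 2 * pi"
  by (simp add: measure_restrict_space)

lemma finite_measure_circ: "finite_measure circ"
  by (rule finite_measureI) (simp add: emeasure_restrict_space emeasure_lborel_Icc_eq)

interpretation circ: finite_measure circ
  by (rule finite_measure_circ)

lemma integrable_circ_continuous [intro]:
  fixes g :: "real \<Rightarrow> real"
  assumes "continuous_on UNIV g"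
  shows "integrable circ g"
  by (rule continuous_imp_integrable_real) (rule continuous_on_subset[OF assms], simp)

lemma measurable_circ:
  assumes "g \<in> borel_measurable lebesgue"
  shows "g \<in> borel_measurable circ"
  using assms by (rule measurable_restrict_space1)

lemma measurable_lebesgue_affine:
  fixes g :: "real \<Rightarrow> real"
  assumes "g \<in> borel_measurable lebesgue" "m \<noteq> 0"
  shows "(\<lambda>t. g (c + m * t)) \<in> borel_measurable lebesgue"
proof -
  have "(\<lambda>t::real. c + m * t) \<in> lebesgue \<rightarrow>\<^sub>M lebesgue"
    using lebesgue_affine_measurable[of "\<lambda>_::real. m" c] assms(2) by simp
  then show ?thesis using assms(1) by (rule measurable_compose)
qed

lemma continuous_measurable_lebesgue:
  fixes g :: "real \<Rightarrow> real"
  assumes "continuous_on UNIV g"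
  shows "g \<in> borel_measurable lebesgue"
  using borel_measurable_continuous_onI[OF assms] by (simp add: measurable_completion)

lemma borel_measurable_lebesgue:
  fixes g :: "real \<Rightarrow> real"
  assumes "g \<in> borel_measurable borel"
  shows "g \<in> borel_measurable lebesgue"
  using assms by (simp add: measurable_completion)

subsection \<open>Integrals of periodic functions over a period\<close>

lemma periodic_2piD: "periodic_2pi f \<Longrightarrow> f (x + 2 * pi) = f x"
  by (simp add: periodic_2pi_def)

lemma periodic_2pi_int:
  assumes "periodic_2pi f"
  shows "f (x + of_int k * (2 * pi)) = f x"
proof (induction k rule: int_induct[where k = 0])
  case (step1 i)
  have "f (x + of_int (i + 1) * (2 * pi)) = f ((x + of_int i * (2 * pi)) + 2 * pi)"
    by (simp add: algebra_simps)
  then show ?case using step1 periodic_2piD[OF assms] by simp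
next
  case (step2 i)
  have "f (x + of_int i * (2 * pi)) = f ((x + of_int (i - 1) * (2 * pi)) + 2 * pi)"
    by (simp add: algebra_simps)
  then show ?case using step2 periodic_2piD[OF assms] by simp
qed simp

text \<open>A translation by a multiple of 2 pi moves the left end \<open>b\<close> of the window to
  some \<open>d\<close> in [a, a + 2 pi). The piece [a, d) of the old window, translated by one more
  period, joins [d, a + 2 pi) to form the window starting at \<open>d\<close>. Half-open windows
  make the pieces tile without overlap.\<close>

lemma has_integral_period:
  fixes h :: "real \<Rightarrow> real"
  assumes per: "periodic_2pi h"
    and h: "has_bochner_integral lebesgue (\<lambda>t. indicator {a..<a+2*pi} t * h t) I"
  shows "has_bochner_integral lebesgue (\<lambda>t. indicator {b..<b+2*pi} t * h t) I"
proof -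
  define k where "k = \<lfloor>(b - a) / (2 * pi)\<rfloor>"
  define s where "s = of_int k * (2 * pi)"
  define d where "d = b - s"
  have "of_int k \<le> (b - a) / (2 * pi)" "(b - a) / (2 * pi) < of_int k + 1"
    unfolding k_def by linarith+
  then have d: "a \<le> d" "d < a + 2 * pi"
    by (auto simp: d_def s_def field_simps)
  have hs: "h (x + s) = h x" for x
    unfolding s_def by (rule periodic_2pi_int[OF per])
  have h2: "h (x + 2 * pi) = h x" for x
    by (rule periodic_2piD[OF per])
  let ?f = "\<lambda>t. indicator {a..<a+2*pi} t * h t"
  have int: "integrable lebesgue ?f" and I: "integral\<^sup>L lebesgue ?f = I"
    using h by (auto simp: has_bochner_integral_iff)
  have int1: "integrable lebesgue (\<lambda>t. indicator {a..<d} t * h t)"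
    using integrable_mult_indicator[of "{a..<d}", OF _ int]
    by (rule Bochner_Integration.integrable_cong[THEN iffD1, rotated 2])
       (use d in \<open>auto simp: indicator_def\<close>)
  have int2: "integrable lebesgue (\<lambda>t. indicator {d..<a+2*pi} t * h t)"
    using integrable_mult_indicator[of "{d..<a+2*pi}", OF _ int]
    by (rule Bochner_Integration.integrable_cong[THEN iffD1, rotated 2])
       (use d in \<open>auto simp: indicator_def\<close>)
  have b1: "has_bochner_integral lebesgue (\<lambda>t. indicator {a..<d} t * h t)
      (integral\<^sup>L lebesgue (\<lambda>t. indicator {a..<d} t * h t))" (is "has_bochner_integral _ _ ?I1")
    using int1 by (rule has_bochner_integral_integrable)
  have b2: "has_bochner_integral lebesgue (\<lambda>t. indicator {d..<a+2*pi} t * h t)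
      (integral\<^sup>L lebesgue (\<lambda>t. indicator {d..<a+2*pi} t * h t))" (is "has_bochner_integral _ _ ?I2")
    using int2 by (rule has_bochner_integral_integrable)
  have "has_bochner_integral lebesgue
      (\<lambda>t. indicator {a..<d} t * h t + indicator {d..<a+2*pi} t * h t) (?I1 + ?I2)"
    by (rule has_bochner_integral_add[OF b1 b2])
  moreover have "(\<lambda>t. indicator {a..<d} t * h t + indicator {d..<a+2*pi} t * h t) = ?f"
    using d by (auto simp: indicator_def fun_eq_iff)
  ultimately have II: "?I1 + ?I2 = I"
    using h by (simp add: has_bochner_integral_eq)
  have "has_bochner_integral lebesgue (\<lambda>t. indicator {a..<d} (-2*pi + 1 * t) * h (-2*pi + 1 * t)) (?I1 /\<^sub>R \<bar>1\<bar>)"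
    using b1 by (subst has_bochner_integral_lebesgue_real_affine_iff[symmetric]) auto
  moreover have "(\<lambda>t. indicator {a..<d} (-2*pi + 1 * t) * h (-2*pi + 1 * t))
      = (\<lambda>t. indicator {a+2*pi..<d+2*pi} t * h t)"
  proof
    fix t show "indicator {a..<d} (-2*pi + 1 * t) * h (-2*pi + 1 * t) = indicator {a+2*pi..<d+2*pi} t * h t"
      using h2[of "t - 2 * pi"] by (auto simp: indicator_def)
  qed
  ultimately have b3: "has_bochner_integral lebesgue (\<lambda>t. indicator {a+2*pi..<d+2*pi} t * h t) ?I1"
    by simp
  have "has_bochner_integral lebesgue
      (\<lambda>t. indicator {d..<a+2*pi} t * h t + indicator {a+2*pi..<d+2*pi} t * h t) (?I2 + ?I1)"
    by (rule has_bochner_integral_add[OF b2 b3])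
  moreover have "(\<lambda>t. indicator {d..<a+2*pi} t * h t + indicator {a+2*pi..<d+2*pi} t * h t)
      = (\<lambda>t. indicator {d..<d+2*pi} t * h t)"
    using d by (auto simp: indicator_def fun_eq_iff)
  ultimately have "has_bochner_integral lebesgue (\<lambda>t. indicator {d..<d+2*pi} t * h t) I"
    using II by (simp add: add.commute)
  then have "has_bochner_integral lebesgue
      (\<lambda>t. indicator {d..<d+2*pi} (-s + 1 * t) * h (-s + 1 * t)) (I /\<^sub>R \<bar>1\<bar>)"
    by (subst has_bochner_integral_lebesgue_real_affine_iff[symmetric]) auto
  moreover have "(\<lambda>t. indicator {d..<d+2*pi} (-s + 1 * t) * h (-s + 1 * t))
      = (\<lambda>t. indicator {b..<b+2*pi} t * h t)"
  proof
    fix t show "indicator {d..<d+2*pi} (-s + 1 * t) * h (-s + 1 * t) = indicator {b..<b+2*pi} t * h t"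
      using hs[of "t - s"] by (auto simp: indicator_def d_def)
  qed
  ultimately show ?thesis by simp
qed

text \<open>The measure \<open>circ\<close> lives on the closed interval, the tiling argument on the
  half-open one; they differ by the null set {pi}.\<close>

lemma has_integral_circ_iff:
  fixes h :: "real \<Rightarrow> real"
  assumes h: "h \<in> borel_measurable lebesgue"
  shows "has_bochner_integral circ h I \<longleftrightarrow>
    has_bochner_integral lebesgue (\<lambda>t. indicator {-pi..<-pi+2*pi} t * h t) I"
proof -
  have "has_bochner_integral circ h I \<longleftrightarrow>
      has_bochner_integral lebesgue (\<lambda>t. indicator {-pi..pi} t *\<^sub>R h t) I"
    by (rule has_bochner_integral_restrict_space) auto
  also have "\<dots> \<longleftrightarrow> has_bochner_integral lebesgue (\<lambda>t. indicator {-pi..<-pi+2*pi} t * h t) I"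
  proof (rule has_bochner_integral_cong_AE)
    have "{pi} \<in> null_sets lebesgue" by simp
    then have "AE t in lebesgue. t \<notin> {pi}" by (rule AE_not_in)
    then show "AE t in lebesgue. indicator {-pi..pi} t *\<^sub>R h t = indicator {-pi..<-pi+2*pi} t * h t"
      by eventually_elim (auto simp: indicator_def)
  qed (auto intro!: borel_measurable_times borel_measurable_indicator h)
  finally show ?thesis .
qed

lemma has_integral_circ_shift:
  fixes h :: "real \<Rightarrow> real"
  assumes h: "h \<in> borel_measurable lebesgue" "periodic_2pi h"
    and I: "has_bochner_integral circ h I"
  shows "has_bochner_integral circ (\<lambda>t. h (t + c)) I"
proof -
  have "has_bochner_integral lebesgue (\<lambda>t. indicator {-pi..<-pi+2*pi} t * h t) I"
    using I has_integral_circ_iff[OF h(1)] by blast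
  then have "has_bochner_integral lebesgue (\<lambda>t. indicator {c-pi..<c-pi+2*pi} t * h t) I"
    by (rule has_integral_period[OF h(2)])
  then have "has_bochner_integral lebesgue
      (\<lambda>t. indicator {c-pi..<c-pi+2*pi} (c + 1 * t) * h (c + 1 * t)) (I /\<^sub>R \<bar>1\<bar>)"
    by (subst has_bochner_integral_lebesgue_real_affine_iff[symmetric]) auto
  moreover have "(\<lambda>t. indicator {c-pi..<c-pi+2*pi} (c + 1 * t) * h (c + 1 * t))
      = (\<lambda>t. indicator {-pi..<-pi+2*pi} t * h (t + c))"
    by (auto simp: indicator_def fun_eq_iff add.commute)
  moreover have "(\<lambda>t. h (t + c)) \<in> borel_measurable lebesgue"
    using measurable_lebesgue_affine[OF h(1), of 1 c] by (simp add: add.commute)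
  ultimately show ?thesis
    using has_integral_circ_iff[of "\<lambda>t. h (t + c)" I] by simp
qed

lemma
  fixes h :: "real \<Rightarrow> real"
  assumes h: "h \<in> borel_measurable lebesgue" "periodic_2pi h" "integrable circ h"
  shows integrable_circ_shift: "integrable circ (\<lambda>t. h (t + c))"
    and integral_circ_shift: "(\<integral>t. h (t + c) \<partial>circ) = (\<integral>t. h t \<partial>circ)"
  using has_integral_circ_shift[OF h(1,2) has_bochner_integral_integrable[OF h(3)]]
  by (auto simp: has_bochner_integral_iff)

lemma
  fixes h :: "real \<Rightarrow> real"
  assumes h: "h \<in> borel_measurable lebesgue" "periodic_2pi h" "integrable circ h"
  shows integrable_circ_reflect: "integrable circ (\<lambda>t. h (c - t))"
    and integral_circ_reflect: "(\<integral>t. h (c - t) \<partial>circ) = (\<integral>t. h t \<partial>circ)"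
proof -
  have "has_bochner_integral circ (\<lambda>t. h (t + c)) (\<integral>t. h t \<partial>circ)"
    by (rule has_integral_circ_shift[OF h(1,2) has_bochner_integral_integrable[OF h(3)]])
  then have "has_bochner_integral (lebesgue_on {-pi..-(-pi)}) (\<lambda>t. h (- t + c)) (\<integral>t. h t \<partial>circ)"
    by (rule has_bochner_integral_reflect_real_lemma)
  then have "has_bochner_integral circ (\<lambda>t. h (c - t)) (\<integral>t. h t \<partial>circ)"
    by simp
  then show "integrable circ (\<lambda>t. h (c - t))" "(\<integral>t. h (c - t) \<partial>circ) = (\<integral>t. h t \<partial>circ)"
    by (auto simp: has_bochner_integral_iff)
qed

subsection \<open>Norms on the circle\<close>

text \<open>A real-valued norm for the kernels, which are continuous and hence have finite
  integrals; the test functions keep the extended-real \<open>Lp_norm\<close>.\<close>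

definition circ_norm :: "real \<Rightarrow> (real \<Rightarrow> real) \<Rightarrow> real" where
  "circ_norm q g = (\<integral>t. \<bar>g t\<bar> powr q \<partial>circ) powr (1 / q)"

lemma circ_norm_nonneg: "0 \<le> circ_norm q g"
  by (simp add: circ_norm_def)

lemma continuous_abs_powr:
  assumes "continuous_on UNIV g" "0 < (q::real)"
  shows "continuous_on UNIV (\<lambda>t. \<bar>g t\<bar> powr q)"
  using assms by (intro continuous_on_powr' continuous_intros) auto

lemma integrable_circ_abs_powr:
  fixes g :: "real \<Rightarrow> real"
  assumes "continuous_on UNIV g" "0 < q"
  shows "integrable circ (\<lambda>t. \<bar>g t\<bar> powr q)"
  by (rule integrable_circ_continuous) (rule continuous_abs_powr[OF assms])

lemma circ_norm_powr:
  assumes "0 < q"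
  shows "circ_norm q g powr q = (\<integral>t. \<bar>g t\<bar> powr q \<partial>circ)"
  using assms by (simp add: circ_norm_def powr_powr powr_one_gt_zero_iff integral_nonneg_AE)

text \<open>Convexity on the open half-line (\<open>powr_convex\<close>), extended to the boundary:
  if one argument vanishes, the bound \<open>v powr q \<le> v\<close> for weights in (0, 1]
  suffices.\<close>

lemma powr_convex_combination:
  fixes a b u v q :: real
  assumes "1 \<le> q" "0 \<le> a" "0 \<le> b" "0 < u" "0 < v" "u + v = 1"
  shows "(u * a + v * b) powr q \<le> u * a powr q + v * b powr q"
proof -
  have *: "v powr q \<le> v" if "0 < v" "v \<le> 1" for v :: real
    using powr_mono'[of 1 q v] that assms(1) by simp
  have aux: "(u * a + v * b) powr q \<le> u * a powr q + v * b powr q"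
    if "a = 0 \<or> b = 0"
  proof -
    have "(u * a) powr q \<le> u * a powr q" "(v * b) powr q \<le> v * b powr q"
      using *[of u] *[of v] assms by (auto simp: powr_mult intro!: mult_right_mono)
    then show ?thesis using that assms by auto
  qed
  show ?thesis
  proof (cases "a = 0 \<or> b = 0")
    case False
    then have "a \<in> {0<..}" "b \<in> {0<..}" using assms by auto
    moreover have u: "u = 1 - v" using assms by simp
    ultimately show ?thesis
      unfolding u using convex_onD[OF powr_convex[OF assms(1)], of v a b] assms by simp
  qed (rule aux)
qed

text \<open>Minkowski's inequality for \<open>g\<close> and a constant, with (2 pi) powr (1/q)
  bounded by 2 pi so that the error does not depend on \<open>q\<close>. The two summands are
  normalised by numbers \<open>A\<close> and \<open>B\<close> above their norms, and convexity of
  the q-th power is applied with weights A / (A + B) and B / (A + B).\<close>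

lemma circ_norm_perturb:
  fixes g h :: "real \<Rightarrow> real"
  assumes q: "1 \<le> q" and g: "continuous_on UNIV g" and h: "continuous_on UNIV h"
    and \<delta>: "\<And>t. \<bar>h t - g t\<bar> \<le> \<delta>"
  shows "circ_norm q h \<le> circ_norm q g + 2 * pi * \<delta>"
proof (rule field_le_epsilon)
  fix e :: real assume e: "0 < e"
  have \<delta>0: "0 \<le> \<delta>" using \<delta>[of 0] by linarith
  \<comment> \<open>The extra e / 2 keeps both divisors positive even if the norm of
    \<open>g\<close> or \<delta> vanishes; the total cost is \<open>e\<close>.\<close>
  define A where "A = circ_norm q g + e / 2"
  define B where "B = 2 * pi * \<delta> + e / 2"
  have A: "0 < A" and B: "0 < B"
    using e \<delta>0 circ_norm_nonneg[of q g] by (auto simp: A_def B_def add_nonneg_pos)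
  have pt: "\<bar>h t\<bar> powr q \<le> (A + B) powr q *
      (A / (A + B) * (\<bar>g t\<bar> powr q / A powr q) + B / (A + B) * (\<delta> / B) powr q)" for t
  proof -
    have "\<bar>h t\<bar> \<le> \<bar>g t\<bar> + \<delta>" using \<delta>[of t] by linarith
    also have "\<dots> = (A + B) * (A / (A + B) * (\<bar>g t\<bar> / A) + B / (A + B) * (\<delta> / B))"
      using A B by (simp add: distrib_left)
    finally have "\<bar>h t\<bar> powr q \<le> ((A + B) * (A / (A + B) * (\<bar>g t\<bar> / A) + B / (A + B) * (\<delta> / B))) powr q"
      using q by (intro powr_mono2) auto
    also have "\<dots> = (A + B) powr q * (A / (A + B) * (\<bar>g t\<bar> / A) + B / (A + B) * (\<delta> / B)) powr q"
      by (rule powr_mult)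
    also have "\<dots> \<le> (A + B) powr q * (A / (A + B) * (\<bar>g t\<bar> / A) powr q + B / (A + B) * (\<delta> / B) powr q)"
      using A B \<delta>0 q
      by (intro mult_left_mono powr_convex_combination) (auto simp: add_divide_distrib[symmetric])
    finally show ?thesis using A by (simp add: powr_divide)
  qed
  have gint: "integrable circ (\<lambda>t. \<bar>g t\<bar> powr q)" and hint: "integrable circ (\<lambda>t. \<bar>h t\<bar> powr q)"
    using integrable_circ_abs_powr g h q by auto
  have "circ_norm q g powr q \<le> A powr q"
    using e q circ_norm_nonneg[of q g] by (intro powr_mono2) (auto simp: A_def)
  then have gA: "(\<integral>t. \<bar>g t\<bar> powr q \<partial>circ) / A powr q \<le> 1"
    using A q by (simp add: circ_norm_powr)
  have dB: "2 * pi * (\<delta> / B) powr q \<le> 1"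
  proof -
    have "2 * pi * (\<delta> / B) powr q \<le> (2 * pi) powr q * (\<delta> / B) powr q"
      using powr_mono[of 1 q "2 * pi"] q pi_gt3 by (intro mult_right_mono) auto
    also have "\<dots> = (2 * pi * (\<delta> / B)) powr q"
      by (rule powr_mult[symmetric])
    also have "\<dots> \<le> 1 powr q"
      using e B \<delta>0 q by (intro powr_mono2) (auto simp: B_def field_simps)
    finally show ?thesis by simp
  qed
  have "(\<integral>t. \<bar>h t\<bar> powr q \<partial>circ) \<le> (\<integral>t. (A + B) powr q *
      (A / (A + B) * (\<bar>g t\<bar> powr q / A powr q) + B / (A + B) * (\<delta> / B) powr q) \<partial>circ)"
    using gint hint by (intro integral_mono pt) auto
  also have "\<dots> = (A + B) powr q *
      (A / (A + B) * ((\<integral>t. \<bar>g t\<bar> powr q \<partial>circ) / A powr q)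
        + B / (A + B) * (2 * pi * (\<delta> / B) powr q))"
    using gint by simp
  also have "\<dots> \<le> (A + B) powr q * (A / (A + B) * 1 + B / (A + B) * 1)"
    using A B by (intro mult_left_mono add_mono gA dB) auto
  also have "\<dots> = (A + B) powr q"
    using A B by (simp add: add_divide_distrib[symmetric])
  finally have "circ_norm q h \<le> ((A + B) powr q) powr (1 / q)"
    unfolding circ_norm_def using q by (intro powr_mono2) (auto intro: integral_nonneg_AE)
  also have "\<dots> = circ_norm q g + 2 * pi * \<delta> + e"
    using A B q by (simp add: powr_powr A_def B_def)
  finally show "circ_norm q h \<le> circ_norm q g + 2 * pi * \<delta> + e" .
qed

lemma circ_norm_shift:
  assumes "0 < q" "continuous_on UNIV g" "periodic_2pi g"
  shows "circ_norm q (\<lambda>t. g (t + c)) = circ_norm q g"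
    and "circ_norm q (\<lambda>t. g (c - t)) = circ_norm q g"
proof -
  have h: "(\<lambda>t. \<bar>g t\<bar> powr q) \<in> borel_measurable lebesgue"
    "periodic_2pi (\<lambda>t. \<bar>g t\<bar> powr q)" "integrable circ (\<lambda>t. \<bar>g t\<bar> powr q)"
    using assms continuous_measurable_lebesgue[OF continuous_abs_powr] integrable_circ_abs_powr
    by (auto simp: periodic_2pi_def)
  show "circ_norm q (\<lambda>t. g (t + c)) = circ_norm q g"
    using integral_circ_shift[OF h, of c] by (simp add: circ_norm_def)
  show "circ_norm q (\<lambda>t. g (c - t)) = circ_norm q g"
    using integral_circ_reflect[OF h, of c] by (simp add: circ_norm_def)
qed

lemma circ_norm_le_sup:
  assumes q: "1 \<le> q" and g: "continuous_on UNIV g" and C: "\<And>t. \<bar>g t\<bar> \<le> C"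
  shows "circ_norm q g \<le> 2 * pi * C"
  using circ_norm_perturb[OF q _ g, of "\<lambda>_. 0" C] C q
  by (simp add: circ_norm_def[of _ "\<lambda>_. 0"])

lemma integrable_circ_mult:
  assumes f: "integrable circ f" and g: "continuous_on UNIV g"
  shows "integrable circ (\<lambda>t. f t * g t :: real)"
proof -
  have "bounded (g ` {-pi..pi})"
    by (intro compact_imp_bounded compact_continuous_image continuous_on_subset[OF g]) auto
  then obtain C where C: "\<And>t. t \<in> {-pi..pi} \<Longrightarrow> \<bar>g t\<bar> \<le> C"
    unfolding bounded_iff by force
  have "integrable circ (\<lambda>t. C * \<bar>f t\<bar>)" using f by simp
  then show ?thesis
  proof (rule Bochner_Integration.integrable_bound)
    show "(\<lambda>t. f t * g t) \<in> borel_measurable circ"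
      using f measurable_circ[OF continuous_measurable_lebesgue[OF g]] by measurable
    show "AE t in circ. norm (f t * g t) \<le> norm (C * \<bar>f t\<bar>)"
    proof (rule AE_I2)
      fix t assume "t \<in> space circ"
      then have "\<bar>g t\<bar> \<le> \<bar>C\<bar>" using C[of t] by auto
      then show "norm (f t * g t) \<le> norm (C * \<bar>f t\<bar>)"
        using mult_left_mono[of "\<bar>g t\<bar>" "\<bar>C\<bar>" "\<bar>f t\<bar>"] by (simp add: abs_mult mult.commute)
    qed
  qed
qed

subsection \<open>The unit balls of the spaces \<open>L\<^sub>p\<close>\<close>

text \<open>Removes the root and the extended reals: membership in the unit ball is checked on
  integrals alone.\<close>

lemma Lp_norm_finite_le_1_iff:
  assumes p: "1 \<le> p" and f: "f \<in> borel_measurable lebesgue"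
  shows "Lp_norm (ereal p) f \<le> 1 \<longleftrightarrow>
    integrable circ (\<lambda>t. \<bar>f t\<bar> powr p) \<and> (\<integral>t. \<bar>f t\<bar> powr p \<partial>circ) \<le> 1"
proof -
  define I where "I = (\<integral>\<^sup>+ t. ennreal (\<bar>f t\<bar> powr p) \<partial>circ)"
  have meas: "(\<lambda>t. \<bar>f t\<bar> powr p) \<in> borel_measurable circ"
    using measurable_circ[OF f] by measurable
  have int: "integrable circ (\<lambda>t. \<bar>f t\<bar> powr p) \<longleftrightarrow> I \<noteq> \<infinity>"
    using meas by (simp add: integrable_iff_bounded I_def top.not_eq_extremum)
  have val: "(\<integral>t. \<bar>f t\<bar> powr p \<partial>circ) = enn2real I"
    unfolding I_def using meas by (intro integral_eq_nn_integral) auto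
  have "ereal (enn2real I powr (1 / p)) \<le> 1 \<longleftrightarrow> enn2real I \<le> 1"
  proof
    assume "ereal (enn2real I powr (1 / p)) \<le> 1"
    then have "enn2real I powr (1 / p) \<le> 1" by (simp add: one_ereal_def)
    then have "(enn2real I powr (1 / p)) powr p \<le> 1 powr p"
      using p by (intro powr_mono2) auto
    then show "enn2real I \<le> 1" using p by (simp add: powr_powr)
  next
    assume "enn2real I \<le> 1"
    then have "enn2real I powr (1 / p) \<le> 1 powr (1 / p)"
      using p by (intro powr_mono2) auto
    then show "ereal (enn2real I powr (1 / p)) \<le> 1" by (simp add: one_ereal_def)
  qed
  then show ?thesis
    unfolding int val by (auto simp: Lp_norm_def I_def[symmetric] Let_def)
qed

lemma Lp_norm_infinity_le_1_iff:
  assumes f: "f \<in> borel_measurable lebesgue"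
  shows "Lp_norm \<infinity> f \<le> 1 \<longleftrightarrow> (AE t in circ. \<bar>f t\<bar> \<le> 1)"
proof -
  have meas: "(\<lambda>t. ereal \<bar>f t\<bar>) \<in> borel_measurable circ"
    using measurable_circ[OF f] by measurable
  have "AE t in circ. \<bar>f t\<bar> \<le> 1" if "esssup circ (\<lambda>t. ereal \<bar>f t\<bar>) \<le> 1"
    using esssup_AE[of "\<lambda>t. ereal \<bar>f t\<bar>" circ]
    by eventually_elim (use that in \<open>metis ereal_less_eq(3) one_ereal_def order_trans\<close>)
  moreover have "esssup circ (\<lambda>t. ereal \<bar>f t\<bar>) \<le> 1" if "AE t in circ. \<bar>f t\<bar> \<le> 1"
    using that by (intro esssup_I meas) (simp add: one_ereal_def)
  ultimately show ?thesis by (auto simp: Lp_norm_def)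
qed

lemma Lp_norm_le_1_cases:
  assumes "1 \<le> p"
  obtains "p = \<infinity>" | r where "p = ereal r" "1 \<le> r"
  using assms by (cases p) (auto simp: one_ereal_def)

text \<open>On a finite measure space all unit balls consist of integrable functions, because |f| is
  at most 1 + |f|^r for finite exponents r.\<close>

lemma integrable_unit_ball:
  assumes p: "1 \<le> p" and f: "f \<in> borel_measurable lebesgue" "Lp_norm p f \<le> 1"
  shows "integrable circ f"
proof -
  obtain g where g: "integrable circ g" "AE t in circ. \<bar>f t\<bar> \<le> g t"
  proof (cases rule: Lp_norm_le_1_cases[OF p])
    case 1
    then show ?thesis using that[of "\<lambda>_. 1"] f Lp_norm_infinity_le_1_iff[OF f(1)] by auto
  next
    case (2 r)
    have "\<bar>f t\<bar> \<le> 1 + \<bar>f t\<bar> powr r" for t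
    proof (cases "\<bar>f t\<bar> \<le> 1")
      case False
      then show ?thesis using powr_mono[of 1 r "\<bar>f t\<bar>"] 2 by simp
    qed (simp add: add_increasing2)
    then show ?thesis
      using that[of "\<lambda>t. 1 + \<bar>f t\<bar> powr r"] f Lp_norm_finite_le_1_iff[of r f] 2 by auto
  qed
  show ?thesis
    by (rule Bochner_Integration.integrable_bound[OF g(1) measurable_circ[OF f(1)]])
      (use g(2) in eventually_elim, auto)
qed

text \<open>Turns the extended-real conjugacy relation into real inequalities, with p = infinity
  kept apart because its norm is an essential supremum.\<close>

lemma conjugate_exponent_cases:
  fixes p :: ereal and q :: real
  assumes "1 < p" "1 / p + 1 / ereal q = 1"
  obtains "p = \<infinity>" "q = 1"
    | p' where "p = ereal p'" "1 < p'" "1 < q" "1 / p' + 1 / q = 1"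
proof (cases p)
  case PInf
  then have "1 / ereal q = 1" using assms(2) by simp
  then have "q = 1" by (cases "q = 0") (auto simp: one_ereal_def)
  with PInf that show ?thesis by blast
next
  case (real p')
  have p': "1 < p'" using real assms(1) by (simp add: one_ereal_def)
  \<comment> \<open>In the extended reals 1 / 0 is infinite, so \<open>q = 0\<close> would violate
    the relation.\<close>
  have q0: "q \<noteq> 0" using assms(2) real p' by (auto simp: one_ereal_def zero_ereal_def[symmetric])
  have e: "1 / p' + 1 / q = 1" using assms(2) real p' q0 by (simp add: one_ereal_def)
  then have q: "1 / q = 1 - 1 / p'" by simp
  have "0 < 1 - 1 / p'" "1 - 1 / p' < 1" using p' by auto
  then have "0 < 1 / q" "1 / q < 1" using q by auto
  then have "1 < q" by (simp add: divide_less_eq split: if_splits)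
  then show ?thesis using that(2) real p' e by blast
next
  case MInf
  then show ?thesis using assms(1) by simp
qed

text \<open>Young's inequality after scaling \<open>g\<close> by a number \<open>A\<close> above its
  norm; the slack \<open>e\<close> covers the case of norm zero. For p = infinity the bound is
  pointwise almost everywhere.\<close>

lemma holder_circ:
  assumes pq: "1 < p" "1 / p + 1 / ereal q = 1"
    and f: "f \<in> borel_measurable lebesgue" "Lp_norm p f \<le> 1"
    and g: "continuous_on UNIV g"
  shows "\<bar>\<integral>t. f t * g t \<partial>circ\<bar> \<le> circ_norm q g"
proof -
  have intf: "integrable circ f" using integrable_unit_ball[OF _ f] pq(1) by simp
  have fg: "integrable circ (\<lambda>t. f t * g t)" by (rule integrable_circ_mult[OF intf g])
  show ?thesis
  proof (cases rule: conjugate_exponent_cases[OF pq])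
    case 1
    then have ae: "AE t in circ. \<bar>f t\<bar> \<le> 1" using Lp_norm_infinity_le_1_iff f by blast
    have "\<bar>\<integral>t. f t * g t \<partial>circ\<bar> \<le> (\<integral>t. \<bar>f t * g t\<bar> \<partial>circ)"
      by (rule integral_abs_bound)
    also have "\<dots> \<le> (\<integral>t. \<bar>g t\<bar> \<partial>circ)"
    proof (rule integral_mono_AE)
      show "AE t in circ. \<bar>f t * g t\<bar> \<le> \<bar>g t\<bar>"
        using ae by eventually_elim (simp add: abs_mult mult_left_le_one_le)
    qed (use fg integrable_circ_continuous[OF g] in auto)
    also have "\<dots> = circ_norm q g" using 1 by (simp add: circ_norm_def integral_nonneg_AE)
    finally show ?thesis .
  next
    case (2 p')
    have fp: "integrable circ (\<lambda>t. \<bar>f t\<bar> powr p')" "(\<integral>t. \<bar>f t\<bar> powr p' \<partial>circ) \<le> 1"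
      using Lp_norm_finite_le_1_iff[of p' f] f 2 by auto
    have gq: "integrable circ (\<lambda>t. \<bar>g t\<bar> powr q)"
      using integrable_circ_abs_powr[OF g] 2 by simp
    show ?thesis
    proof (rule field_le_epsilon)
      fix e :: real assume e: "0 < e"
      define A where "A = circ_norm q g + e"
      have A: "0 < A" using e circ_norm_nonneg[of q g] by (simp add: A_def)
      have "circ_norm q g powr q \<le> A powr q"
        using e 2 circ_norm_nonneg[of q g] by (intro powr_mono2) (auto simp: A_def)
      then have gA: "(\<integral>t. \<bar>g t\<bar> powr q \<partial>circ) / A powr q \<le> 1"
        using A 2 by (simp add: circ_norm_powr)
      have pt: "\<bar>f t * g t\<bar> \<le> A * (\<bar>f t\<bar> powr p' / p' + \<bar>g t\<bar> powr q / A powr q / q)" for t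
      proof -
        have "\<bar>f t\<bar> * (\<bar>g t\<bar> / A) \<le> \<bar>f t\<bar> powr p' / p' + (\<bar>g t\<bar> / A) powr q / q"
          using 2 A by (intro Youngs_inequality) auto
        then show ?thesis using A by (simp add: abs_mult field_simps powr_divide)
      qed
      have "\<bar>\<integral>t. f t * g t \<partial>circ\<bar> \<le> (\<integral>t. \<bar>f t * g t\<bar> \<partial>circ)"
        by (rule integral_abs_bound)
      also have "\<dots> \<le> (\<integral>t. A * (\<bar>f t\<bar> powr p' / p' + \<bar>g t\<bar> powr q / A powr q / q) \<partial>circ)"
        using fg fp gq by (intro integral_mono pt) auto
      also have "\<dots> = A * ((\<integral>t. \<bar>f t\<bar> powr p' \<partial>circ) / p' + (\<integral>t. \<bar>g t\<bar> powr q \<partial>circ) / A powr q / q)"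
        using fp gq by simp
      also have "\<dots> \<le> A * (1 / p' + 1 / q)"
        using A fp gA 2 by (intro mult_left_mono add_mono divide_right_mono) auto
      finally show "\<bar>\<integral>t. f t * g t \<partial>circ\<bar> \<le> circ_norm q g + e"
        using 2 by (simp add: A_def)
    qed
  qed
qed

text \<open>The endpoint p = 1, where the dual norm is a supremum; \<open>C\<close> is any bound for
  it.\<close>

lemma holder_circ_1:
  assumes f: "f \<in> borel_measurable lebesgue" "Lp_norm 1 f \<le> 1"
    and g: "continuous_on UNIV g" and C: "\<And>t. \<bar>g t\<bar> \<le> C"
  shows "\<bar>\<integral>t. f t * g t \<partial>circ\<bar> \<le> C"
proof -
  have f1: "integrable circ (\<lambda>t. \<bar>f t\<bar>)" "(\<integral>t. \<bar>f t\<bar> \<partial>circ) \<le> 1"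
    using Lp_norm_finite_le_1_iff[of 1 f] f by (auto simp: one_ereal_def)
  have C0: "0 \<le> C" using C[of 0] by linarith
  have fg: "integrable circ (\<lambda>t. f t * g t)"
    using integrable_circ_mult[OF integrable_unit_ball[OF _ f] g] by simp
  have "\<bar>\<integral>t. f t * g t \<partial>circ\<bar> \<le> (\<integral>t. \<bar>f t * g t\<bar> \<partial>circ)"
    by (rule integral_abs_bound)
  also have "\<dots> \<le> (\<integral>t. \<bar>f t\<bar> * C \<partial>circ)"
  proof (rule integral_mono)
    show "\<bar>f t * g t\<bar> \<le> \<bar>f t\<bar> * C" for t
      using C[of t] by (simp add: abs_mult mult_left_mono)
  qed (use integrable_abs[OF fg] f1 in auto)
  also have "\<dots> = (\<integral>t. \<bar>f t\<bar> \<partial>circ) * C"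
    by simp
  also have "\<dots> \<le> 1 * C"
    by (rule mult_right_mono[OF f1(2) C0])
  finally show ?thesis by simp
qed

subsection \<open>Extremal functions\<close>

text \<open>The equality case of Hoelder's inequality, attained by sgn(g) |g|^(q - 1) after
  normalisation.\<close>

lemma exists_extremal:
  assumes pq: "1 < p" "1 / p + 1 / ereal q = 1"
    and g: "continuous_on UNIV g" "periodic_2pi g"
  obtains f where "f \<in> borel_measurable lebesgue" "periodic_2pi f" "Lp_norm p f \<le> 1"
    "(\<integral>t. f t * g t \<partial>circ) = circ_norm q g"
proof -
  define A where "A = circ_norm q g"
  \<comment> \<open>If \<open>A\<close> is zero, division by zero makes \<open>f\<close> the zero
    function, which still satisfies the claim. For q = 1 and A > 0 the formula reduces to the sign
    of \<open>g\<close>.\<close>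
  define f where "f = (\<lambda>t. sgn (g t) * \<bar>g t\<bar> powr (q - 1) / A powr (q - 1))"
  have A0: "0 \<le> A" by (simp add: A_def circ_norm_nonneg)
  have q: "1 \<le> q" using conjugate_exponent_cases[OF pq] by (cases rule: conjugate_exponent_cases[OF pq]) auto
  have gm: "g \<in> borel_measurable borel" using g(1) by (rule borel_measurable_continuous_onI)
  have fm: "f \<in> borel_measurable lebesgue"
  proof (rule borel_measurable_lebesgue)
    note gm [measurable]
    show "f \<in> borel_measurable borel" unfolding f_def by measurable
  qed
  have fp: "periodic_2pi f" using g(2) by (simp add: f_def periodic_2pi_def)
  have Aq: "A powr q = (\<integral>t. \<bar>g t\<bar> powr q \<partial>circ)"
    using q by (simp add: A_def circ_norm_powr)
  have gq: "integrable circ (\<lambda>t. \<bar>g t\<bar> powr q)"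
    using integrable_circ_abs_powr[OF g(1)] q by simp
  have fg: "(\<integral>t. f t * g t \<partial>circ) = A"
  proof -
    have "f t * g t = \<bar>g t\<bar> powr q / A powr (q - 1)" for t
    proof (cases "g t = 0")
      case False
      have "sgn (g t) * g t = \<bar>g t\<bar>" by (simp add: sgn_if)
      moreover have "\<bar>g t\<bar> * \<bar>g t\<bar> powr (q - 1) = \<bar>g t\<bar> powr q"
        using powr_mult_base[of "\<bar>g t\<bar>" "q - 1"] by simp
      ultimately have "sgn (g t) * g t * \<bar>g t\<bar> powr (q - 1) = \<bar>g t\<bar> powr q"
        by simp
      then show ?thesis by (simp add: f_def mult_ac)
    qed (simp add: f_def)
    then have "(\<integral>t. f t * g t \<partial>circ) = A powr q / A powr (q - 1)"
      using Aq by simp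
    also have "\<dots> = A"
      using A0 by (cases "A = 0") (auto simp: powr_diff)
    finally show ?thesis .
  qed
  have "Lp_norm p f \<le> 1"
  proof (cases rule: conjugate_exponent_cases[OF pq])
    case 1
    have "\<bar>f t\<bar> \<le> 1" for t
      using 1 by (auto simp: f_def sgn_if)
    then show ?thesis using Lp_norm_infinity_le_1_iff[OF fm] 1 by simp
  next
    case (2 p')
    \<comment> \<open>Conjugacy of the exponents makes the p'-th power of \<open>f\<close> a
      multiple of the q-th power of \<open>g\<close>.\<close>
    have e: "(q - 1) * p' = q" using 2 by (simp add: field_simps)
    have pt: "\<bar>f t\<bar> powr p' = \<bar>g t\<bar> powr q / A powr q" for t
    proof (cases "g t = 0")
      case False
      then have "\<bar>f t\<bar> = \<bar>g t\<bar> powr (q - 1) / A powr (q - 1)"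
        by (simp add: f_def abs_mult abs_sgn_eq)
      then show ?thesis by (simp add: powr_divide powr_powr e)
    qed (use 2 in \<open>simp add: f_def\<close>)
    have "(\<integral>t. \<bar>f t\<bar> powr p' \<partial>circ) = A powr q / A powr q"
      unfolding pt using Aq by simp
    then have "(\<integral>t. \<bar>f t\<bar> powr p' \<partial>circ) \<le> 1" by simp
    then show ?thesis
      using Lp_norm_finite_le_1_iff[of p' f] fm 2 gq by (simp add: pt)
  qed
  with fm fp fg show ?thesis by (intro that[of f]) (auto simp: A_def)
qed

text \<open>For p = 1 the supremum of \<open>g\<close> need not be attained. Mass one spread evenly
  over the set where \<open>g\<close> exceeds \<open>s\<close> yields at least
  \<open>s\<close>.\<close>

lemma exists_extremal_1:
  assumes g: "continuous_on UNIV g" "periodic_2pi g" and s: "s < g t0"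
  obtains f where "f \<in> borel_measurable lebesgue" "periodic_2pi f" "Lp_norm 1 f \<le> 1"
    "s \<le> (\<integral>t. f t * g t \<partial>circ)"
proof -
  define E where "E = {t. s < g t}"
  define m where "m = measure circ (E \<inter> {-pi..pi})"
  define f where "f = (\<lambda>t. indicator E t / m :: real)"
  have openE: "open E"
    unfolding E_def using g(1) by (intro open_Collect_less) auto
  have Em: "E \<in> sets lebesgue" using openE by simp
  \<comment> \<open>The superlevel set must have positive measure within one period. By periodicity
    it contains a translate of \<open>t0\<close> in [-pi, pi]; as this may be an endpoint, the
    argument passes from the open interval to its closure.\<close>
  have "E \<inter> {-pi<..<pi} \<noteq> {}"
  proof
    assume *: "E \<inter> {-pi<..<pi} = {}"
    then have "E \<inter> closure {-pi<..<pi} = {}"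
      using openE open_Int_closure_eq_empty by blast
    then have **: "E \<inter> {-pi..pi} = {}" by simp
    define k where "k = \<lfloor>(t0 + pi) / (2 * pi)\<rfloor>"
    have "of_int k \<le> (t0 + pi) / (2 * pi)" "(t0 + pi) / (2 * pi) < of_int k + 1"
      unfolding k_def by linarith+
    then have "t0 + of_int (- k) * (2 * pi) \<in> {-pi..pi}"
      by (auto simp: field_simps)
    moreover have "t0 + of_int (- k) * (2 * pi) \<in> E"
      using s by (simp only: E_def mem_Collect_eq periodic_2pi_int[OF g(2)])
    ultimately show False using ** by blast
  qed
  moreover have "open (E \<inter> {-pi<..<pi})" using openE by auto
  ultimately have "E \<inter> {-pi<..<pi} \<notin> null_sets lebesgue"
    using open_not_negligible negligible_iff_null_sets by blast
  moreover have "E \<inter> {-pi<..<pi} \<in> sets lebesgue" using Em by auto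
  ultimately have "emeasure lebesgue (E \<inter> {-pi<..<pi}) \<noteq> 0" by auto
  moreover have "emeasure lebesgue (E \<inter> {-pi<..<pi}) \<le> emeasure lebesgue (E \<inter> {-pi..pi})"
    using Em by (intro emeasure_mono) auto
  moreover have "emeasure lebesgue (E \<inter> {-pi..pi}) = emeasure circ (E \<inter> {-pi..pi})"
    by (subst emeasure_restrict_space) auto
  ultimately have "emeasure circ (E \<inter> {-pi..pi}) \<noteq> 0" by auto
  then have m: "0 < m" unfolding m_def
    by (simp add: circ.emeasure_eq_measure zero_less_measure_iff)
  have fm: "f \<in> borel_measurable lebesgue"
    unfolding f_def using Em by measurable
  have fp: "periodic_2pi f" using g(2) by (simp add: f_def E_def periodic_2pi_def indicator_def)
  have fi: "integrable circ f"
    using m by (intro circ.integrable_const_bound[where B = "1 / m"] measurable_circ fm)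
      (auto simp: f_def indicator_def)
  have f1: "(\<integral>t. f t \<partial>circ) = 1"
    using m by (simp add: f_def m_def)
  have fn: "0 \<le> f t" for t using m by (simp add: f_def)
  have "Lp_norm 1 f \<le> 1"
    using Lp_norm_finite_le_1_iff[of 1 f] fm fi f1 fn by (simp add: one_ereal_def)
  moreover have "s \<le> (\<integral>t. f t * g t \<partial>circ)"
  proof -
    have "s = (\<integral>t. f t * s \<partial>circ)" using f1 by simp
    also have "\<dots> \<le> (\<integral>t. f t * g t \<partial>circ)"
    proof (rule integral_mono)
      show "f t * s \<le> f t * g t" for t
        using m by (auto simp: f_def E_def indicator_def divide_right_mono)
    qed (use fi integrable_circ_mult[OF fi g(1)] in auto)
    finally show ?thesis .
  qed
  ultimately show ?thesis using fm fp that by blast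
qed

lemma Lp_norm_midpoint_le_1:
  assumes p: "1 \<le> p" and f: "f \<in> borel_measurable lebesgue" "Lp_norm p f \<le> 1"
    and g: "g \<in> borel_measurable lebesgue" "Lp_norm p g \<le> 1"
  shows "Lp_norm p (\<lambda>t. (f t + g t) / 2) \<le> 1"
proof -
  have m: "(\<lambda>t. (f t + g t) / 2) \<in> borel_measurable lebesgue" using f g by measurable
  show ?thesis
  proof (cases rule: Lp_norm_le_1_cases[OF p])
    case 1
    have "AE t in circ. \<bar>f t\<bar> \<le> 1" "AE t in circ. \<bar>g t\<bar> \<le> 1"
      using Lp_norm_infinity_le_1_iff f g 1 by auto
    then have "AE t in circ. \<bar>(f t + g t) / 2\<bar> \<le> 1"
      by eventually_elim auto
    then show ?thesis using Lp_norm_infinity_le_1_iff[OF m] 1 by simp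
  next
    case (2 r)
    have F: "integrable circ (\<lambda>t. \<bar>f t\<bar> powr r)" "(\<integral>t. \<bar>f t\<bar> powr r \<partial>circ) \<le> 1"
      and G: "integrable circ (\<lambda>t. \<bar>g t\<bar> powr r)" "(\<integral>t. \<bar>g t\<bar> powr r \<partial>circ) \<le> 1"
      using Lp_norm_finite_le_1_iff f g 2 by auto
    have pt: "\<bar>(f t + g t) / 2\<bar> powr r \<le> (\<bar>f t\<bar> powr r + \<bar>g t\<bar> powr r) / 2" for t
    proof -
      have "\<bar>(f t + g t) / 2\<bar> powr r \<le> (1/2 * \<bar>f t\<bar> + 1/2 * \<bar>g t\<bar>) powr r"
        using 2 by (intro powr_mono2) auto
      also have "\<dots> \<le> 1/2 * \<bar>f t\<bar> powr r + 1/2 * \<bar>g t\<bar> powr r"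
        using 2 by (intro powr_convex_combination) auto
      finally show ?thesis by simp
    qed
    have FG: "integrable circ (\<lambda>t. (\<bar>f t\<bar> powr r + \<bar>g t\<bar> powr r) / 2)" using F G by simp
    have I: "integrable circ (\<lambda>t. \<bar>(f t + g t) / 2\<bar> powr r)"
    proof (rule Bochner_Integration.integrable_bound[OF FG])
      show "(\<lambda>t. \<bar>(f t + g t) / 2\<bar> powr r) \<in> borel_measurable circ"
        using measurable_circ[OF m] by measurable
    qed (use pt in auto)
    have "(\<integral>t. \<bar>(f t + g t) / 2\<bar> powr r \<partial>circ) \<le> (\<integral>t. (\<bar>f t\<bar> powr r + \<bar>g t\<bar> powr r) / 2 \<partial>circ)"
      by (rule integral_mono[OF I FG pt])
    also have "\<dots> \<le> 1" using F G by simp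
    finally show ?thesis using Lp_norm_finite_le_1_iff[of r, OF _ m] I 2 by simp
  qed
qed

text \<open>For finite exponents this is invariance of the integral of |f|^r. For p = infinity the
  same invariance is applied to the indicator of {|f| > 1}, whose integral vanishes exactly when
  that set is null.\<close>

lemma Lp_norm_shift_le_1:
  assumes p: "1 \<le> p" and f: "f \<in> borel_measurable lebesgue" "periodic_2pi f" "Lp_norm p f \<le> 1"
    and m: "m = 1 \<or> m = -1"
  shows "Lp_norm p (\<lambda>t. f (c + m * t)) \<le> 1"
proof -
  have mf: "(\<lambda>t. f (c + m * t)) \<in> borel_measurable lebesgue"
    using m by (intro measurable_lebesgue_affine f) auto
  have shift: "integrable circ (\<lambda>t. h (c + m * t)) \<and> (\<integral>t. h (c + m * t) \<partial>circ) = (\<integral>t. h t \<partial>circ)"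
    if "h \<in> borel_measurable lebesgue" "periodic_2pi h" "integrable circ h" for h
    using m integrable_circ_shift[OF that, of c] integral_circ_shift[OF that, of c]
      integrable_circ_reflect[OF that, of c] integral_circ_reflect[OF that, of c]
    by (auto simp: add.commute)
  show ?thesis
  proof (cases rule: Lp_norm_le_1_cases[OF p])
    case 1
    define h where "h = (\<lambda>t. indicator {t. 1 < \<bar>f t\<bar>} t :: real)"
    have ae: "AE t in circ. \<bar>f t\<bar> \<le> 1" using Lp_norm_infinity_le_1_iff f 1 by auto
    have hm: "h \<in> borel_measurable lebesgue" unfolding h_def using f by measurable
    have hp: "periodic_2pi h" using f by (simp add: h_def periodic_2pi_def indicator_def)
    have hae: "AE t in circ. h t = 0"
      using ae by eventually_elim (simp add: h_def)
    then have h0: "integrable circ h" "(\<integral>t. h t \<partial>circ) = 0"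
      using measurable_circ[OF hm] by (auto simp: integral_eq_zero_AE
        intro!: integrable_cong_AE_imp[of circ "\<lambda>_. 0"])
    have "AE t in circ. h (c + m * t) = 0"
    proof (subst integral_nonneg_eq_0_iff_AE[symmetric])
      show "integrable circ (\<lambda>t. h (c + m * t))" using shift[OF hm hp h0(1)] by simp
      show "AE t in circ. 0 \<le> h (c + m * t)" by (simp add: h_def)
      show "(\<integral>t. h (c + m * t) \<partial>circ) = 0" using shift[OF hm hp h0(1)] h0 by simp
    qed
    then have "AE t in circ. \<bar>f (c + m * t)\<bar> \<le> 1"
      by eventually_elim (auto simp: h_def indicator_def split: if_splits)
    then show ?thesis using Lp_norm_infinity_le_1_iff[OF mf] 1 by simp
  next
    case (2 r)
    have F: "integrable circ (\<lambda>t. \<bar>f t\<bar> powr r)" "(\<integral>t. \<bar>f t\<bar> powr r \<partial>circ) \<le> 1"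
      using Lp_norm_finite_le_1_iff f 2 by auto
    have "(\<lambda>t. \<bar>f t\<bar> powr r) \<in> borel_measurable lebesgue" "periodic_2pi (\<lambda>t. \<bar>f t\<bar> powr r)"
      using f by (measurable, simp add: periodic_2pi_def)
    from shift[OF this F(1)] F(2) show ?thesis
      using Lp_norm_finite_le_1_iff[of r, OF _ mf] 2 by simp
  qed
qed

lemma Lp_norm_minus [simp]: "Lp_norm p (\<lambda>t. - f t) = Lp_norm p f"
  by (simp add: Lp_norm_def)

lemma Bp0D:
  assumes "f \<in> Bp0 p"
  shows "f \<in> borel_measurable lebesgue" "periodic_2pi f" "Lp_norm p f \<le> 1" "(\<integral>t. f t \<partial>circ) = 0"
  using assms by (auto simp: Bp0_def Lp_space_def set_LINT_circ)

lemma Bp0I: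
  assumes "f \<in> borel_measurable lebesgue" "periodic_2pi f" "Lp_norm p f \<le> 1" "(\<integral>t. f t \<partial>circ) = 0"
  shows "f \<in> Bp0 p"
proof -
  have "Lp_norm p f < \<infinity>" using assms(3) by (rule le_less_trans) simp
  with assms show ?thesis by (auto simp: Bp0_def Lp_space_def set_LINT_circ)
qed

text \<open>If \<open>g\<close> nearly changes sign under the shift by \<open>h\<close>, then antisymmetrising a test function
  along this shift gives it mean zero at almost no cost.\<close>

lemma exists_mean_zero:
  assumes p: "1 \<le> p" and f: "f \<in> borel_measurable lebesgue" "periodic_2pi f" "Lp_norm p f \<le> 1"
    and g: "continuous_on UNIV g" "periodic_2pi g"
  obtains \<phi> where "\<phi> \<in> Bp0 p"
    "(\<integral>t. \<phi> (- t) * g t \<partial>circ) =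
       (\<integral>t. f t * g t \<partial>circ) - (\<integral>t. f t * (g t + g (t - h)) \<partial>circ) / 2"
proof -
  define \<psi> where "\<psi> = (\<lambda>t. (f t + - f (h + 1 * t)) / 2)"
  \<comment> \<open>The reflection prepares for a convolution evaluated at 0, where the test
    function enters with argument -t.\<close>
  define \<phi> where "\<phi> = (\<lambda>t. \<psi> (0 + (-1) * t))"
  have fh: "(\<lambda>t. f (h + 1 * t)) \<in> borel_measurable lebesgue"
    by (intro measurable_lebesgue_affine f) auto
  have \<psi>m: "\<psi> \<in> borel_measurable lebesgue"
    unfolding \<psi>_def using f(1) fh by measurable
  have fI: "integrable circ f" using integrable_unit_ball[OF p f(1,3)] .
  have \<psi>p: "periodic_2pi \<psi>"
    unfolding periodic_2pi_def
  proof
    fix x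
    have "h + 1 * (x + 2 * pi) = h + 1 * x + 2 * pi" by simp
    then show "\<psi> (x + 2 * pi) = \<psi> x"
      unfolding \<psi>_def by (simp only: periodic_2piD[OF f(2)])
  qed
  have \<psi>1: "Lp_norm p \<psi> \<le> 1"
    unfolding \<psi>_def using Lp_norm_shift_le_1[OF p f, of 1 h] fh
    by (intro Lp_norm_midpoint_le_1[OF p f(1,3)]) auto
  have fhI: "integrable circ (\<lambda>t. f (t + h))" "(\<integral>t. f (t + h) \<partial>circ) = (\<integral>t. f t \<partial>circ)"
    using integrable_circ_shift[OF f(1,2) fI, of h] integral_circ_shift[OF f(1,2) fI, of h] by auto
  have \<psi>I: "integrable circ \<psi>" and \<psi>0: "(\<integral>t. \<psi> t \<partial>circ) = 0"
    using fI fhI by (auto simp: \<psi>_def add.commute)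
  have gh: "continuous_on UNIV (\<lambda>t. g (t - h))"
    by (intro continuous_on_compose2[OF g(1)] continuous_intros) auto
  have fg: "integrable circ (\<lambda>t. f t * g t)" "integrable circ (\<lambda>t. f t * g (t - h))"
    "integrable circ (\<lambda>t. f (t + h) * g t)"
    using integrable_circ_mult fI fhI g gh by auto
  show thesis
  proof (rule that)
    show "\<phi> \<in> Bp0 p"
    proof (rule Bp0I)
      show "\<phi> \<in> borel_measurable lebesgue"
        unfolding \<phi>_def by (intro measurable_lebesgue_affine \<psi>m) auto
      show "periodic_2pi \<phi>"
        unfolding periodic_2pi_def
      proof
        fix x
        have "\<psi> (- x - 2 * pi) = \<psi> (- x - 2 * pi + 2 * pi)"
          by (rule periodic_2piD[OF \<psi>p, symmetric])
        then show "\<phi> (x + 2 * pi) = \<phi> x" by (simp add: \<phi>_def)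
      qed
      show "Lp_norm p \<phi> \<le> 1"
        unfolding \<phi>_def by (rule Lp_norm_shift_le_1[OF p \<psi>m \<psi>p \<psi>1]) simp
      show "(\<integral>t. \<phi> t \<partial>circ) = 0"
        using integral_circ_reflect[OF \<psi>m \<psi>p \<psi>I, of 0] \<psi>0 by (simp add: \<phi>_def)
    qed
    \<comment> \<open>The shift is moved from \<open>f\<close> to \<open>g\<close>, so that the
      defect appears as the near-cancelling sum g t + g (t - h).\<close>
    have "(\<integral>t. f (t + h) * g t \<partial>circ) = (\<integral>t. f (t + h) * g ((t + h) - h) \<partial>circ)"
      by simp
    also have "\<dots> = (\<integral>t. f t * g (t - h) \<partial>circ)"
    proof (rule integral_circ_shift[where h = "\<lambda>t. f t * g (t - h)"])
      show "(\<lambda>t. f t * g (t - h)) \<in> borel_measurable lebesgue"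
        using f(1) continuous_measurable_lebesgue[OF gh] by measurable
      show "periodic_2pi (\<lambda>t. f t * g (t - h))"
        unfolding periodic_2pi_def
      proof
        fix x
        have "x + 2 * pi - h = x - h + 2 * pi" by simp
        then have "g (x + 2 * pi - h) = g (x - h)" by (simp only: periodic_2piD[OF g(2)])
        then show "f (x + 2 * pi) * g (x + 2 * pi - h) = f x * g (x - h)"
          by (simp only: periodic_2piD[OF f(2)])
      qed
    qed (use fg in auto)
    finally have sh: "(\<integral>t. f (t + h) * g t \<partial>circ) = (\<integral>t. f t * g (t - h) \<partial>circ)" .
    have "(\<integral>t. \<phi> (- t) * g t \<partial>circ) = (\<integral>t. (f t * g t - f (t + h) * g t) / 2 \<partial>circ)"
      by (simp add: \<phi>_def \<psi>_def algebra_simps)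
    also have "\<dots> = ((\<integral>t. f t * g t \<partial>circ) - (\<integral>t. f t * g (t - h) \<partial>circ)) / 2"
      using fg sh by simp
    also have "\<dots> = (\<integral>t. f t * g t \<partial>circ) - (\<integral>t. f t * (g t + g (t - h)) \<partial>circ) / 2"
      using fg by (simp add: distrib_left field_simps)
    finally show "(\<integral>t. \<phi> (- t) * g t \<partial>circ) =
       (\<integral>t. f t * g t \<partial>circ) - (\<integral>t. f t * (g t + g (t - h)) \<partial>circ) / 2" .
  qed
qed

subsection \<open>Trigonometric series\<close>

lemma integral_cos_int:
  "(\<integral>t. cos (real_of_int k * t) \<partial>circ) = (if k = 0 then 2 * pi else 0)"
proof (cases "k = 0")
  case False
  have c: "continuous_on UNIV (\<lambda>t. cos (real_of_int k * t))"
    by (intro continuous_intros)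
  have "(\<integral>t. cos (real_of_int k * t) \<partial>circ) = integral {-pi..pi} (\<lambda>t. cos (real_of_int k * t))"
    by (rule lebesgue_integral_eq_integral[OF integrable_circ_continuous[OF c]]) simp
  also have "((\<lambda>t. cos (real_of_int k * t)) has_integral
      (sin (real_of_int k * pi) / real_of_int k - sin (real_of_int k * (-pi)) / real_of_int k)) {-pi..pi}"
    using False
    by (intro fundamental_theorem_of_calculus)
       (auto simp flip: has_real_derivative_iff_has_vector_derivative intro!: derivative_eq_intros)
  then have "integral {-pi..pi} (\<lambda>t. cos (real_of_int k * t)) = 0"
    by (auto dest: integral_unique simp: sin_npi_int mult.commute)
  finally show ?thesis using False by simp
qed simp

lemma integral_sin_int: "(\<integral>t. sin (real_of_int k * t) \<partial>circ) = 0"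
proof -
  have c: "continuous_on UNIV (\<lambda>t. sin (real_of_int k * t))"
    by (intro continuous_intros)
  have per: "periodic_2pi (\<lambda>t. sin (real_of_int k * t))"
    unfolding periodic_2pi_def
  proof
    fix x
    have "real_of_int k * (x + 2 * pi) = real_of_int k * x + of_int k * (2 * pi)"
      by (simp add: algebra_simps)
    moreover have "periodic_2pi sin" by (simp add: periodic_2pi_def)
    ultimately show "sin (real_of_int k * (x + 2 * pi)) = sin (real_of_int k * x)"
      by (metis periodic_2pi_int)
  qed
  have "(\<integral>t. sin (real_of_int k * (0 - t)) \<partial>circ) = (\<integral>t. sin (real_of_int k * t) \<partial>circ)"
    by (rule integral_circ_reflect[OF continuous_measurable_lebesgue[OF c] per integrable_circ_continuous[OF c]])
  then show ?thesis by simp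
qed

lemma integral_cos_nat: "(\<integral>t. cos (real k * t) \<partial>circ) = (if k = 0 then 2 * pi else 0)"
  and integral_sin_nat: "(\<integral>t. sin (real k * t) \<partial>circ) = 0"
  using integral_cos_int[of "int k"] integral_sin_int[of "int k"] by simp_all

lemma integral_trig_combination:
  fixes a b :: real
  shows "(\<integral>t. (cos (a * t) + cos (b * t)) / 2 \<partial>circ) = ((\<integral>t. cos (a * t) \<partial>circ) + (\<integral>t. cos (b * t) \<partial>circ)) / 2"
    and "(\<integral>t. (cos (a * t) - cos (b * t)) / 2 \<partial>circ) = ((\<integral>t. cos (a * t) \<partial>circ) - (\<integral>t. cos (b * t) \<partial>circ)) / 2"
    and "(\<integral>t. (sin (a * t) + sin (b * t)) / 2 \<partial>circ) = ((\<integral>t. sin (a * t) \<partial>circ) + (\<integral>t. sin (b * t) \<partial>circ)) / 2"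
proof -
  have "integrable circ (\<lambda>t. cos (c * t))" "integrable circ (\<lambda>t. sin (c * t))" for c :: real
    by (intro integrable_circ_continuous continuous_intros)+
  then show "(\<integral>t. (cos (a * t) + cos (b * t)) / 2 \<partial>circ) = ((\<integral>t. cos (a * t) \<partial>circ) + (\<integral>t. cos (b * t) \<partial>circ)) / 2"
    "(\<integral>t. (cos (a * t) - cos (b * t)) / 2 \<partial>circ) = ((\<integral>t. cos (a * t) \<partial>circ) - (\<integral>t. cos (b * t) \<partial>circ)) / 2"
    "(\<integral>t. (sin (a * t) + sin (b * t)) / 2 \<partial>circ) = ((\<integral>t. sin (a * t) \<partial>circ) + (\<integral>t. sin (b * t) \<partial>circ)) / 2"
    by simp_all
qed

lemma integral_cos_cos:
  "(\<integral>t. cos (real (Suc j) * t) * cos (real (Suc k) * t) \<partial>circ) = (if j = k then pi else 0)"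
proof -
  have *: "cos (real (Suc j) * t) * cos (real (Suc k) * t) =
      (cos (real_of_int (int j - int k) * t) + cos (real_of_int (int j + int k + 2) * t)) / 2" for t
    by (simp add: cos_times_cos algebra_simps)
  show ?thesis
    unfolding * integral_trig_combination integral_cos_int by auto
qed

lemma integral_sin_sin:
  "(\<integral>t. sin (real (Suc j) * t) * sin (real (Suc k) * t) \<partial>circ) = (if j = k then pi else 0)"
proof -
  have *: "sin (real (Suc j) * t) * sin (real (Suc k) * t) =
      (cos (real_of_int (int j - int k) * t) - cos (real_of_int (int j + int k + 2) * t)) / 2" for t
    by (simp add: sin_times_sin algebra_simps)
  show ?thesis
    unfolding * integral_trig_combination integral_cos_int by auto
qed

lemma integral_sin_cos:
  "(\<integral>t. sin (real (Suc j) * t) * cos (real (Suc k) * t) \<partial>circ) = 0"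
proof -
  have *: "sin (real (Suc j) * t) * cos (real (Suc k) * t) =
      (sin (real_of_int (int j + int k + 2) * t) + sin (real_of_int (int j - int k) * t)) / 2" for t
  proof -
    have "real_of_int (int j + int k + 2) * t = real (Suc j) * t + real (Suc k) * t"
      "real_of_int (int j - int k) * t = real (Suc j) * t - real (Suc k) * t"
      by (simp_all add: algebra_simps)
    then show ?thesis by (simp only: sin_times_cos)
  qed
  show ?thesis
    unfolding * integral_trig_combination integral_sin_int by auto
qed

lemma summable_bounded_terms:
  fixes c :: "nat \<Rightarrow> real"
  assumes "summable (\<lambda>k. \<bar>c k\<bar>)" "\<And>k. \<bar>e k\<bar> \<le> C"
  shows "summable (\<lambda>k. \<bar>c k * e k\<bar>)"
  by (rule summable_comparison_test'[OF summable_mult2[OF assms(1), of C]])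
     (use assms(2) in \<open>auto simp: abs_mult intro!: mult_left_mono\<close>)

lemma continuous_series:
  fixes c :: "nat \<Rightarrow> real" and e :: "nat \<Rightarrow> real \<Rightarrow> real"
  assumes c: "summable (\<lambda>k. \<bar>c k\<bar>)" and e: "\<And>k. continuous_on UNIV (e k)" "\<And>k t. \<bar>e k t\<bar> \<le> 1"
  shows "continuous_on UNIV (\<lambda>t. \<Sum>k. c k * e k t)"
proof (rule uniform_limit_theorem)
  show "uniform_limit UNIV (\<lambda>n t. \<Sum>k<n. c k * e k t) (\<lambda>t. \<Sum>k. c k * e k t) sequentially"
    by (rule Weierstrass_m_test[OF _ c])
       (use e(2) in \<open>auto simp: abs_mult intro!: mult_left_le\<close>)
  show "\<forall>\<^sub>F n in sequentially. continuous_on UNIV (\<lambda>t. \<Sum>k<n. c k * e k t)"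
    by (intro always_eventually allI continuous_intros e)
qed auto

text \<open>Since |f e_k| is at most |f|, absolute summability of the coefficients justifies
  termwise integration for any integrable \<open>f\<close>.\<close>

lemma
  fixes c :: "nat \<Rightarrow> real" and e :: "nat \<Rightarrow> real \<Rightarrow> real"
  assumes f: "integrable circ f" and c: "summable (\<lambda>k. \<bar>c k\<bar>)"
    and e: "\<And>k. continuous_on UNIV (e k)" "\<And>k t. \<bar>e k t\<bar> \<le> 1"
  shows integral_series: "(\<integral>t. f t * (\<Sum>k. c k * e k t) \<partial>circ) = (\<Sum>k. c k * (\<integral>t. f t * e k t \<partial>circ))"
    and integral_series_bound: "\<bar>\<integral>t. f t * e k t \<partial>circ\<bar> \<le> (\<integral>t. \<bar>f t\<bar> \<partial>circ)"
proof -
  have fe: "integrable circ (\<lambda>t. f t * e k t)" for k by (rule integrable_circ_mult[OF f e(1)])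
  have fe': "\<bar>f t * e k t\<bar> \<le> \<bar>f t\<bar>" for k t
    using e(2)[of k t] by (simp add: abs_mult mult_left_le)
  have feb: "(\<integral>t. \<bar>f t * e k t\<bar> \<partial>circ) \<le> (\<integral>t. \<bar>f t\<bar> \<partial>circ)" for k
    using fe f by (intro integral_mono fe') auto
  have feb': "\<bar>\<integral>t. f t * e k t \<partial>circ\<bar> \<le> (\<integral>t. \<bar>f t\<bar> \<partial>circ)" for k
    using integral_abs_bound[of circ "\<lambda>t. f t * e k t"] feb[of k] by linarith
  then show "\<bar>\<integral>t. f t * e k t \<partial>circ\<bar> \<le> (\<integral>t. \<bar>f t\<bar> \<partial>circ)" .
  have "f t * (\<Sum>k. c k * e k t) = (\<Sum>k. c k * (f t * e k t))" for t
  proof -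
    have "summable (\<lambda>k. c k * e k t)"
      using summable_bounded_terms[OF c e(2)] by (rule summable_rabs_cancel)
    from suminf_mult[OF this, of "f t"] show ?thesis by (simp add: mult_ac)
  qed
  then have "(\<integral>t. f t * (\<Sum>k. c k * e k t) \<partial>circ) = (\<integral>t. (\<Sum>k. c k * (f t * e k t)) \<partial>circ)"
    by simp
  also have "\<dots> = (\<Sum>k. (\<integral>t. c k * (f t * e k t) \<partial>circ))"
  proof (rule integral_suminf)
    show "AE t in circ. summable (\<lambda>k. norm (c k * (f t * e k t)))"
      using summable_bounded_terms[OF c fe'] by simp
    show "summable (\<lambda>k. \<integral>t. norm (c k * (f t * e k t)) \<partial>circ)"
    proof (rule summable_comparison_test'[OF summable_mult2[OF c, of "\<integral>t. \<bar>f t\<bar> \<partial>circ"]])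
      show "norm (\<integral>t. norm (c k * (f t * e k t)) \<partial>circ) \<le> \<bar>c k\<bar> * (\<integral>t. \<bar>f t\<bar> \<partial>circ)" for k
        using mult_left_mono[OF feb[of k], of "\<bar>c k\<bar>"]
        by (simp add: abs_mult integral_nonneg_AE)
    qed
  qed (use fe in auto)
  finally show "(\<integral>t. f t * (\<Sum>k. c k * e k t) \<partial>circ) = (\<Sum>k. c k * (\<integral>t. f t * e k t \<partial>circ))"
    by simp
qed

lemma suminf_if_eq: "(\<Sum>j. c j * (if j = k then v else 0)) = c k * (v :: real)"
  by (subst suminf_finite[of "{k}"]) auto

text \<open>Coefficient \<open>k\<close> belongs to frequency k + 1, and the constant term is halved
  as in \<open>fourier_sum\<close>. Absolute summability makes the termwise integrations below
  legitimate.\<close>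

locale trig_series =
  fixes A :: real and a b :: "nat \<Rightarrow> real" and f :: "real \<Rightarrow> real"
  assumes a: "summable (\<lambda>k. \<bar>a k\<bar>)" and b: "summable (\<lambda>k. \<bar>b k\<bar>)"
    and f: "\<And>t. f t = A / 2 + (\<Sum>k. a k * cos (real (Suc k) * t)) + (\<Sum>k. b k * sin (real (Suc k) * t))"
begin

lemma cont_cos: "continuous_on UNIV (\<lambda>t. \<Sum>k. a k * cos (real (Suc k) * t))"
  by (rule continuous_series[OF a]) (auto intro!: continuous_intros)

lemma cont_sin: "continuous_on UNIV (\<lambda>t. \<Sum>k. b k * sin (real (Suc k) * t))"
  by (rule continuous_series[OF b]) (auto intro!: continuous_intros)

lemma cont: "continuous_on UNIV f"
  unfolding f[abs_def] by (intro continuous_intros cont_cos cont_sin)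

lemma integral_mult:
  assumes g: "continuous_on UNIV g"
  shows "(\<integral>t. g t * f t \<partial>circ) = A / 2 * (\<integral>t. g t \<partial>circ)
    + (\<Sum>k. a k * (\<integral>t. g t * cos (real (Suc k) * t) \<partial>circ))
    + (\<Sum>k. b k * (\<integral>t. g t * sin (real (Suc k) * t) \<partial>circ))"
proof -
  have gi: "integrable circ g" using g by (rule integrable_circ_continuous)
  note [simp] = gi integrable_circ_mult[OF gi cont_cos] integrable_circ_mult[OF gi cont_sin]
  have "(\<integral>t. g t * f t \<partial>circ) = (\<integral>t. A / 2 * g t + g t * (\<Sum>k. a k * cos (real (Suc k) * t))
      + g t * (\<Sum>k. b k * sin (real (Suc k) * t)) \<partial>circ)"
    by (simp add: f algebra_simps)
  also have "\<dots> = A / 2 * (\<integral>t. g t \<partial>circ) + (\<integral>t. g t * (\<Sum>k. a k * cos (real (Suc k) * t)) \<partial>circ)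
      + (\<integral>t. g t * (\<Sum>k. b k * sin (real (Suc k) * t)) \<partial>circ)"
    by (simp del: of_nat_Suc)
  also have "(\<integral>t. g t * (\<Sum>k. a k * cos (real (Suc k) * t)) \<partial>circ)
      = (\<Sum>k. a k * (\<integral>t. g t * cos (real (Suc k) * t) \<partial>circ))"
    by (rule integral_series[OF gi a]) (auto intro!: continuous_intros)
  also have "(\<integral>t. g t * (\<Sum>k. b k * sin (real (Suc k) * t)) \<partial>circ)
      = (\<Sum>k. b k * (\<integral>t. g t * sin (real (Suc k) * t) \<partial>circ))"
    by (rule integral_series[OF gi b]) (auto intro!: continuous_intros)
  finally show ?thesis .
qed

lemma integral_cos_mult: "(\<integral>t. cos (real (Suc k) * t) * f t \<partial>circ) = pi * a k"
proof -
  have c: "continuous_on UNIV (\<lambda>t. cos (real (Suc k) * t))" by (intro continuous_intros)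
  have "(\<integral>t. cos (real (Suc k) * t) * cos (real (Suc j) * t) \<partial>circ) = (if j = k then pi else 0)"
    "(\<integral>t. cos (real (Suc k) * t) * sin (real (Suc j) * t) \<partial>circ) = 0" for j
    using integral_cos_cos[of j k] integral_sin_cos[of j k] by (simp_all only: mult.commute)
  then show ?thesis
    unfolding integral_mult[OF c] integral_cos_nat by (simp add: suminf_if_eq)
qed

lemma integral_sin_mult: "(\<integral>t. sin (real (Suc k) * t) * f t \<partial>circ) = pi * b k"
proof -
  have c: "continuous_on UNIV (\<lambda>t. sin (real (Suc k) * t))" by (intro continuous_intros)
  have "(\<integral>t. sin (real (Suc k) * t) * sin (real (Suc j) * t) \<partial>circ) = (if j = k then pi else 0)" for j
    using integral_sin_sin[of k j] by auto
  then show ?thesis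
    unfolding integral_mult[OF c] integral_sin_nat integral_sin_cos by (simp add: suminf_if_eq)
qed

lemma integral_f: "(\<integral>t. f t \<partial>circ) = pi * A"
proof -
  have "(\<integral>t. f t \<partial>circ) = (\<integral>t. 1 * f t \<partial>circ)" by simp
  also have "\<dots> = A / 2 * (\<integral>t. 1 \<partial>circ)
    + (\<Sum>k. a k * (\<integral>t. 1 * cos (real (Suc k) * t) \<partial>circ))
    + (\<Sum>k. b k * (\<integral>t. 1 * sin (real (Suc k) * t) \<partial>circ))"
    by (rule integral_mult[OF continuous_on_const])
  also have "\<dots> = pi * A"
    unfolding mult_1 integral_cos_nat integral_sin_nat by simp
  finally show ?thesis .
qed

lemma fourier_cos_coeff_0: "fourier_cos_coeff f 0 = A"
  using integral_f by (simp add: fourier_cos_coeff_def set_LINT_circ)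

lemma fourier_cos_coeff_Suc: "fourier_cos_coeff f (Suc k) = a k"
  using integral_cos_mult[of k]
  by (simp add: fourier_cos_coeff_def set_LINT_circ mult.commute[of "f _"] del: of_nat_Suc)

lemma fourier_sin_coeff_Suc: "fourier_sin_coeff f (Suc k) = b k"
  using integral_sin_mult[of k]
  by (simp add: fourier_sin_coeff_def set_LINT_circ mult.commute[of "f _"] del: of_nat_Suc)

lemma fourier_sum_eq:
  "fourier_sum m f x = A / 2 + (\<Sum>k<m. a k * cos (real (Suc k) * x) + b k * sin (real (Suc k) * x))"
proof -
  have "(\<Sum>k=1..m. fourier_cos_coeff f k * cos (real k * x) + fourier_sin_coeff f k * sin (real k * x))
    = (\<Sum>k<m. a k * cos (real (Suc k) * x) + b k * sin (real (Suc k) * x))"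
    by (rule sum.reindex_bij_witness[of _ Suc "\<lambda>k. k - 1"])
       (auto simp: fourier_cos_coeff_Suc[symmetric] fourier_sin_coeff_Suc[symmetric])
  then show ?thesis by (simp add: fourier_sum_def fourier_cos_coeff_0)
qed

text \<open>This is \<open>integral_mult\<close> with \<open>g = f\<close>: the integrals of
  \<open>f\<close> against the cosines and sines are the coefficients already computed.\<close>

lemma parseval:
  "(\<integral>t. (f t)\<^sup>2 \<partial>circ) = pi * A\<^sup>2 / 2 + pi * (\<Sum>k. (a k)\<^sup>2) + pi * (\<Sum>k. (b k)\<^sup>2)"
proof -
  have sq: "summable (\<lambda>k. (c k)\<^sup>2)" if "summable (\<lambda>k. \<bar>c k\<bar>)" for c :: "nat \<Rightarrow> real"
  proof -
    have "\<exists>C. \<forall>k. \<bar>c k\<bar> \<le> C"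
      using summable_imp_Bseq[OF that] by (auto simp: Bseq_def)
    then obtain C where C: "\<And>k. \<bar>c k\<bar> \<le> C" by blast
    show ?thesis
      using summable_rabs_cancel[OF summable_bounded_terms[of c c C, OF that C]]
      by (simp add: power2_eq_square)
  qed
  have "(\<integral>t. (f t)\<^sup>2 \<partial>circ) = (\<integral>t. f t * f t \<partial>circ)"
    by (simp add: power2_eq_square)
  also have "\<dots> = A / 2 * (pi * A) + (\<Sum>k. a k * (pi * a k)) + (\<Sum>k. b k * (pi * b k))"
    unfolding integral_mult[OF cont] mult.commute[of "f _" "cos _"] mult.commute[of "f _" "sin _"]
      integral_f integral_cos_mult integral_sin_mult ..
  also have "\<dots> = pi * A\<^sup>2 / 2 + (\<Sum>k. pi * (a k)\<^sup>2) + (\<Sum>k. pi * (b k)\<^sup>2)"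
    by (simp add: power2_eq_square mult_ac)
  also have "\<dots> = pi * A\<^sup>2 / 2 + pi * (\<Sum>k. (a k)\<^sup>2) + pi * (\<Sum>k. (b k)\<^sup>2)"
    using suminf_mult[OF sq[OF a], of pi] suminf_mult[OF sq[OF b], of pi] by simp
  finally show ?thesis .
qed

end

text \<open>Convolving an integrable function with an absolutely convergent cosine series gives
  another absolutely convergent trigonometric series. Its Fourier sum is therefore an initial
  segment, and what is left is the convolution with the tail of the kernel.\<close>

lemma convolution_remainder:
  fixes c :: "nat \<Rightarrow> real" and \<gamma> :: real
  assumes \<phi>: "\<phi> \<in> borel_measurable lebesgue" "periodic_2pi \<phi>" "integrable circ \<phi>"
    and c: "summable (\<lambda>k. \<bar>c k\<bar>)"
    and f: "\<And>x. f x = a0 / 2 +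
      1 / pi * (\<integral>t. \<phi> (x - t) * (\<Sum>k. c k * cos (real (Suc k) * t - \<gamma>)) \<partial>circ)"
  shows "f x - fourier_sum m f x =
    1 / pi * (\<integral>t. \<phi> (x - t) * (\<Sum>k. c (k + m) * cos (real (Suc (k + m)) * t - \<gamma>)) \<partial>circ)"
proof -
  \<comment> \<open>The phase \<gamma> is absorbed into these coefficients, because cos (k (x - t) -
    \<gamma>) = cos (k x - (k t + \<gamma>)).\<close>
  define X where "X = (\<lambda>k. \<integral>t. \<phi> t * cos (real (Suc k) * t + \<gamma>) \<partial>circ)"
  define Y where "Y = (\<lambda>k. \<integral>t. \<phi> t * sin (real (Suc k) * t + \<gamma>) \<partial>circ)"
  have \<phi>x: "integrable circ (\<lambda>t. \<phi> (x - t))" for x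
    by (rule integrable_circ_reflect[OF \<phi>])
  have conv: "(\<integral>t. \<phi> (x - t) * cos (real (Suc k) * t - \<gamma>) \<partial>circ)
      = cos (real (Suc k) * x) * X k + sin (real (Suc k) * x) * Y k" for k x
  proof -
    define w where "w = (\<lambda>t. cos (real (Suc k) * (x - t) - \<gamma>))"
    have w: "continuous_on UNIV w" unfolding w_def by (intro continuous_intros)
    have "w (t + 2 * pi) = w t" for t
    proof -
      have "real (Suc k) * (x - (t + 2 * pi)) - \<gamma> = (real (Suc k) * (x - t) - \<gamma>) + of_int (- int (Suc k)) * (2 * pi)"
        by (simp add: algebra_simps)
      moreover have "periodic_2pi cos" by (simp add: periodic_2pi_def)
      ultimately show ?thesis unfolding w_def by (metis periodic_2pi_int)
    qed
    then have wp: "periodic_2pi w" by (simp add: periodic_2pi_def)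
    have "(\<integral>t. \<phi> (x - t) * cos (real (Suc k) * t - \<gamma>) \<partial>circ) = (\<integral>t. \<phi> (x - t) * w (x - t) \<partial>circ)"
      by (simp add: w_def)
    also have "\<dots> = (\<integral>t. \<phi> t * w t \<partial>circ)"
    proof (rule integral_circ_reflect[where h = "\<lambda>t. \<phi> t * w t"])
      show "(\<lambda>t. \<phi> t * w t) \<in> borel_measurable lebesgue"
        using \<phi>(1) continuous_measurable_lebesgue[OF w] by measurable
      show "periodic_2pi (\<lambda>t. \<phi> t * w t)"
        using \<phi>(2) wp by (simp add: periodic_2pi_def)
      show "integrable circ (\<lambda>t. \<phi> t * w t)" by (rule integrable_circ_mult[OF \<phi>(3) w])
    qed
    also have "\<dots> = (\<integral>t. cos (real (Suc k) * x) * (\<phi> t * cos (real (Suc k) * t + \<gamma>))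
        + sin (real (Suc k) * x) * (\<phi> t * sin (real (Suc k) * t + \<gamma>)) \<partial>circ)"
    proof (rule Bochner_Integration.integral_cong)
      fix t
      have "real (Suc k) * (x - t) - \<gamma> = real (Suc k) * x - (real (Suc k) * t + \<gamma>)"
        by (simp add: algebra_simps)
      then have "w t = cos (real (Suc k) * x) * cos (real (Suc k) * t + \<gamma>)
          + sin (real (Suc k) * x) * sin (real (Suc k) * t + \<gamma>)"
        unfolding w_def by (simp only: cos_diff)
      then show "\<phi> t * w t = cos (real (Suc k) * x) * (\<phi> t * cos (real (Suc k) * t + \<gamma>))
        + sin (real (Suc k) * x) * (\<phi> t * sin (real (Suc k) * t + \<gamma>))"
        by (simp only: distrib_left mult_ac)
    qed simp
    also have "\<dots> = cos (real (Suc k) * x) * X k + sin (real (Suc k) * x) * Y k"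
    proof -
      have "integrable circ (\<lambda>t. \<phi> t * cos (real (Suc k) * t + \<gamma>))"
        "integrable circ (\<lambda>t. \<phi> t * sin (real (Suc k) * t + \<gamma>))"
        by (intro integrable_circ_mult[OF \<phi>(3)] continuous_intros)+
      then show ?thesis by (simp add: X_def Y_def del: of_nat_Suc)
    qed
    finally show ?thesis .
  qed
  have XY: "\<bar>X k\<bar> \<le> (\<integral>t. \<bar>\<phi> t\<bar> \<partial>circ)" "\<bar>Y k\<bar> \<le> (\<integral>t. \<bar>\<phi> t\<bar> \<partial>circ)" for k
    unfolding X_def Y_def
    using integral_series_bound[OF \<phi>(3) c, of "\<lambda>k t. cos (real (Suc k) * t + \<gamma>)"]
      integral_series_bound[OF \<phi>(3) c, of "\<lambda>k t. sin (real (Suc k) * t + \<gamma>)"]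
    by (simp_all add: continuous_intros)
  \<comment> \<open>The index map \<open>i\<close> is left free because the identity serves both the
    whole series and its tail.\<close>
  have ser: "(\<integral>t. \<phi> (x - t) * (\<Sum>k. d k * cos (real (Suc (i k)) * t - \<gamma>)) \<partial>circ) =
      (\<Sum>k. d k * (cos (real (Suc (i k)) * x) * X (i k) + sin (real (Suc (i k)) * x) * Y (i k)))"
    if "summable (\<lambda>k. \<bar>d k\<bar>)" for d :: "nat \<Rightarrow> real" and i and x
    unfolding conv[symmetric]
    by (rule integral_series[OF \<phi>x that]) (auto intro!: continuous_intros)
  define a where "a = (\<lambda>k. 1 / pi * (c k * X k))"
  define b where "b = (\<lambda>k. 1 / pi * (c k * Y k))"
  have ab: "summable (\<lambda>k. \<bar>a k\<bar>)" "summable (\<lambda>k. \<bar>b k\<bar>)"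
    using summable_mult[OF summable_bounded_terms[OF c XY(1)], of "1 / pi"]
      summable_mult[OF summable_bounded_terms[OF c XY(2)], of "1 / pi"]
    by (auto simp: a_def b_def abs_mult)
  have sa: "summable (\<lambda>k. a k * cos (real (Suc k) * x))" for x
    by (rule summable_rabs_cancel[OF summable_bounded_terms[OF ab(1), of _ 1]]) simp
  have sb: "summable (\<lambda>k. b k * sin (real (Suc k) * x))" for x
    by (rule summable_rabs_cancel[OF summable_bounded_terms[OF ab(2), of _ 1]]) simp
  define u where "u = (\<lambda>k x. a k * cos (real (Suc k) * x) + b k * sin (real (Suc k) * x))"
  have u: "u k x = 1 / pi * (c k * (cos (real (Suc k) * x) * X k + sin (real (Suc k) * x) * Y k))" for k x
    by (simp add: u_def a_def b_def algebra_simps)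
  have su: "summable (\<lambda>k. u k x)" for x
    unfolding u_def by (rule summable_add[OF sa sb])
  have int_u: "1 / pi * (\<integral>t. \<phi> (x - t) * (\<Sum>k. c (k + j) * cos (real (Suc (k + j)) * t - \<gamma>)) \<partial>circ)
      = (\<Sum>k. u (k + j) x)" for x j
  proof -
    have cj: "summable (\<lambda>k. \<bar>c (k + j)\<bar>)" using c by (rule summable_ignore_initial_segment)
    have "summable (\<lambda>k. 1 / pi * (c (k + j) * (cos (real (Suc (k + j)) * x) * X (k + j) + sin (real (Suc (k + j)) * x) * Y (k + j))))"
      using summable_ignore_initial_segment[OF su[of x], of j] by (simp only: u)
    then have "summable (\<lambda>k. c (k + j) * (cos (real (Suc (k + j)) * x) * X (k + j) + sin (real (Suc (k + j)) * x) * Y (k + j)))"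
      by (subst (asm) summable_cmult_iff) simp
    from suminf_mult[OF this, of "1 / pi"] show ?thesis
      by (simp only: ser[OF cj, where i = "\<lambda>k. k + j"] u)
  qed
  have fx: "f x = a0 / 2 + (\<Sum>k. u k x)" for x
    using int_u[of x 0] by (simp add: f)
  interpret trig_series a0 a b f
  proof
    show "f t = a0 / 2 + (\<Sum>k. a k * cos (real (Suc k) * t)) + (\<Sum>k. b k * sin (real (Suc k) * t))" for t
      unfolding fx u_def using suminf_add[OF sa[of t] sb[of t]] by simp
  qed (use ab in auto)
  have "f x - fourier_sum m f x = (\<Sum>k. u (k + m) x)"
    using suminf_split_initial_segment[OF su[of x], of m] fourier_sum_eq[of m x]
    by (simp add: fx u_def)
  also have "\<dots> = 1 / pi * (\<integral>t. \<phi> (x - t) * (\<Sum>k. c (k + m) * cos (real (Suc (k + m)) * t - \<gamma>)) \<partial>circ)"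
    by (rule int_u[symmetric])
  finally show ?thesis .
qed

subsection \<open>The hypergeometric mean\<close>

lemma norm_one_minus_rcis_ge: "0 \<le> \<rho> \<Longrightarrow> 1 - \<rho> \<le> norm (1 - of_real \<rho> * cis t)"
  using norm_triangle_ineq2[of 1 "of_real \<rho> * cis t"] by (simp add: norm_mult)

text \<open>The integrand is the squared modulus of \<open>G\<close>, the power of exponent -q/2 of
  1 - \<rho> e^(it). Its binomial series has coefficients \<alpha>, so Parseval for real and
  imaginary part gives the sum of the squares of \<alpha>, which is the hypergeometric series at the
  square of \<rho>.\<close>

lemma integral_hypergeo:
  assumes \<rho>: "0 \<le> \<rho>" "\<rho> < 1" and q: "0 < q"
  shows "(\<integral>t. norm (1 - of_real \<rho> * cis t) powr (-q) \<partial>circ) = 2 * pi * hypergeo_2F1 (q / 2) (q / 2) 1 (\<rho>\<^sup>2)"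
proof -
  define \<alpha> where "\<alpha> = (\<lambda>n. pochhammer (q / 2) n / fact n * \<rho> ^ n)"
  define G where "G = (\<lambda>t. (1 - of_real \<rho> * cis t) powr (- of_real (q / 2)))"
  have \<alpha>0: "0 \<le> \<alpha> n" for n
    using \<rho> q by (auto simp: \<alpha>_def intro!: mult_nonneg_nonneg divide_nonneg_nonneg pochhammer_nonneg)
  have G: "(\<lambda>n. of_real (\<alpha> n) * cis (real n * t)) sums G t" for t
  proof -
    have "norm (- (of_real \<rho> * cis t)) < 1" using \<rho> by (simp add: norm_mult)
    from gen_binomial_complex[OF this, of "- of_real (q / 2)"]
    have "(\<lambda>n. ((- of_real (q / 2)) gchoose n) * (- (of_real \<rho> * cis t)) ^ n) sums G t"
      by (simp add: G_def)
    moreover have "((- of_real (q / 2)) gchoose n) * (- (of_real \<rho> * cis t)) ^ n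
        = of_real (\<alpha> n) * cis (real n * t)" for n
    proof -
      have "((- of_real (q / 2) :: complex) gchoose n) = (-1) ^ n * of_real (pochhammer (q / 2) n / fact n)"
        unfolding gbinomial_pochhammer minus_minus pochhammer_of_real by simp
      moreover have "(- (of_real \<rho> * cis t)) ^ n = (-1) ^ n * of_real (\<rho> ^ n) * cis (real n * t)"
        by (subst power_minus) (simp add: power_mult_distrib Complex.DeMoivre)
      ultimately have "((- of_real (q / 2)) gchoose n) * (- (of_real \<rho> * cis t)) ^ n
        = ((-1) ^ n * (-1) ^ n) * (of_real (\<alpha> n) * cis (real n * t))"
        by (simp add: \<alpha>_def mult_ac)
      then show ?thesis by (simp flip: power_mult_distrib)
    qed
    ultimately show ?thesis by simp
  qed
  \<comment> \<open>At t = 0 the series is the sum of the nonnegative \<alpha> themselves, so its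
    convergence there is absolute summability.\<close>
  have "(\<lambda>n. Re (of_real (\<alpha> n) * cis (real n * 0))) sums Re (G 0)"
    by (rule sums_Re[OF G])
  then have s\<alpha>: "summable \<alpha>" by (simp add: sums_iff)
  then have sa: "summable (\<lambda>k. \<bar>\<alpha> (Suc k)\<bar>)"
    using \<alpha>0 by (simp add: summable_Suc_iff)
  have \<alpha>_0: "\<alpha> 0 = 1" by (simp add: \<alpha>_def)
  \<comment> \<open>The constant term \<open>\<alpha> 0\<close> = 1 is written as 2 / 2, and the
    absent sine part as a zero series, to match \<open>trig_series\<close>.\<close>
  have ReG: "Re (G t) = 2 / 2 + (\<Sum>k. \<alpha> (Suc k) * cos (real (Suc k) * t)) + (\<Sum>k. 0 * sin (real (Suc k) * t))" for t
    using sums_split_initial_segment[OF sums_Re[OF G[of t]], of 1] \<alpha>_0 by (simp add: sums_iff)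
  have ImG: "Im (G t) = 0 / 2 + (\<Sum>k. 0 * cos (real (Suc k) * t)) + (\<Sum>k. \<alpha> (Suc k) * sin (real (Suc k) * t))" for t
    using sums_split_initial_segment[OF sums_Im[OF G[of t]], of 1] \<alpha>_0 by (simp add: sums_iff)
  interpret R: trig_series 2 "\<lambda>k. \<alpha> (Suc k)" "\<lambda>_. 0" "\<lambda>t. Re (G t)"
    by unfold_locales (use sa ReG in auto)
  interpret I: trig_series 0 "\<lambda>_. 0" "\<lambda>k. \<alpha> (Suc k)" "\<lambda>t. Im (G t)"
    by unfold_locales (use sa ImG in auto)
  have "norm (1 - of_real \<rho> * cis t) powr (-q) = (Re (G t))\<^sup>2 + (Im (G t))\<^sup>2" for t
  proof -
    have "norm (1 - of_real \<rho> * cis t) > 0" using norm_one_minus_rcis_ge[OF \<rho>(1), of t] \<rho> by linarith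
    moreover have "norm (G t) = norm (1 - of_real \<rho> * cis t) powr (- (q / 2))"
      unfolding G_def by (subst norm_powr_real_powr') auto
    ultimately have "norm (1 - of_real \<rho> * cis t) powr (-q) = (norm (G t))\<^sup>2"
      by (simp add: power2_eq_square flip: powr_add)
    then show ?thesis by (simp add: cmod_power2)
  qed
  then have "(\<integral>t. norm (1 - of_real \<rho> * cis t) powr (-q) \<partial>circ)
      = (\<integral>t. (Re (G t))\<^sup>2 \<partial>circ) + (\<integral>t. (Im (G t))\<^sup>2 \<partial>circ)"
    by (simp, intro Bochner_Integration.integral_add integrable_circ_continuous continuous_intros R.cont I.cont)
  also have "\<dots> = 2 * pi * (1 + (\<Sum>k. (\<alpha> (Suc k))\<^sup>2))"
    unfolding R.parseval I.parseval by (simp add: algebra_simps)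
  also have "(\<Sum>k. (\<alpha> (Suc k))\<^sup>2) = (\<Sum>k. pochhammer (q / 2) (Suc k) * pochhammer (q / 2) (Suc k) /
      pochhammer 1 (Suc k) * ((\<rho>\<^sup>2) ^ Suc k / fact (Suc k)))"
  proof (rule suminf_cong)
    fix k
    have "(\<rho> ^ Suc k)\<^sup>2 = (\<rho>\<^sup>2) ^ Suc k"
      by (simp only: power_mult[symmetric] mult.commute)
    moreover have "pochhammer 1 (Suc k) = (fact (Suc k) :: real)" by (rule pochhammer_fact[symmetric])
    ultimately show "(\<alpha> (Suc k))\<^sup>2 = pochhammer (q / 2) (Suc k) * pochhammer (q / 2) (Suc k) /
      pochhammer 1 (Suc k) * ((\<rho>\<^sup>2) ^ Suc k / fact (Suc k))"
      unfolding \<alpha>_def power_mult_distrib power_divide by (simp only: power2_eq_square times_divide_times_eq times_divide_eq_left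
        times_divide_eq_right divide_divide_eq_left)
  qed
  finally show ?thesis by (simp only: hypergeo_2F1_def)
qed

subsection \<open>The Poisson-type kernel\<close>

text \<open>The fast phase \<open>s\<close> is kept apart from the slow variable \<open>t\<close>:
  the kernel is a pure cosine in \<open>s\<close> and Lipschitz in \<open>t\<close>, and the two
  properties are used separately.\<close>

definition pkernel :: "real \<Rightarrow> real \<Rightarrow> real \<Rightarrow> real" where
  "pkernel \<rho> t s = Re (cis s / (1 - of_real \<rho> * cis t))"

text \<open>A chord is no longer than its arc: the squared chord is 4 times the squared sine of half
  the angle difference.\<close>

lemma norm_cis_diff_le: "norm (cis s - cis t) \<le> \<bar>s - t\<bar>"
proof -
  have "(norm (cis s - cis t))\<^sup>2 = (cos s - cos t)\<^sup>2 + (sin s - sin t)\<^sup>2"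
    by (simp add: cmod_power2)
  also have "\<dots> = 2 - 2 * cos (s - t)"
    using sin_cos_squared_add[of s] sin_cos_squared_add[of t]
    by (simp add: cos_diff power2_eq_square algebra_simps)
  also have "\<dots> = 2 - 2 * cos (2 * ((s - t) / 2))"
  proof -
    have "2 * ((s - t) / 2) = s - t" by simp
    then show ?thesis by (simp only:)
  qed
  also have "\<dots> = 4 * (sin ((s - t) / 2))\<^sup>2"
    by (subst cos_double_sin) simp
  also have "\<dots> \<le> 4 * ((s - t) / 2)\<^sup>2"
    using abs_sin_x_le_abs_x[of "(s - t) / 2"] by (simp only: abs_le_square_iff mult_le_cancel_left_pos zero_less_numeral)
  also have "\<dots> = \<bar>s - t\<bar>\<^sup>2" by (simp add: power2_eq_square)
  finally show ?thesis by (rule power2_le_imp_le) simp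
qed

text \<open>The difference of the two reciprocals has numerator \<rho> (cis t - cis t'), and each
  denominator has modulus at least 1 - \<rho>.\<close>

lemma pkernel_lipschitz:
  assumes \<rho>: "0 \<le> \<rho>" "\<rho> < 1"
  shows "\<bar>pkernel \<rho> t s - pkernel \<rho> t' s\<bar> \<le> \<bar>t - t'\<bar> / (1 - \<rho>)\<^sup>2"
proof -
  define w w' where "w = 1 - of_real \<rho> * cis t" and "w' = 1 - of_real \<rho> * cis t'"
  have w: "1 - \<rho> \<le> norm w" "1 - \<rho> \<le> norm w'"
    unfolding w_def w'_def by (rule norm_one_minus_rcis_ge[OF \<rho>(1)])+
  then have nz: "w \<noteq> 0" "w' \<noteq> 0" using \<rho> by auto
  have "\<bar>pkernel \<rho> t s - pkernel \<rho> t' s\<bar> \<le> norm (cis s / w - cis s / w')"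
    using abs_Re_le_cmod[of "cis s / w - cis s / w'"] by (simp add: pkernel_def w_def w'_def)
  also have "cis s / w - cis s / w' = cis s * (of_real \<rho> * (cis t - cis t')) / (w * w')"
    using nz by (simp add: w_def w'_def field_simps)
  also have "norm \<dots> = \<rho> * norm (cis t - cis t') / (norm w * norm w')"
    using \<rho> by (simp add: norm_mult norm_divide)
  also have "\<dots> \<le> 1 * \<bar>t - t'\<bar> / ((1 - \<rho>) * (1 - \<rho>))"
    using w \<rho> norm_cis_diff_le[of t t'] by (intro frac_le mult_mono) auto
  finally show ?thesis by (simp add: power2_eq_square)
qed

text \<open>Separates amplitude and phase: \<open>t\<close> fixes an amplitude and an offset, and
  \<open>s\<close> enters only through one cosine.\<close>

lemma pkernel_polar:
  assumes \<rho>: "0 \<le> \<rho>" "\<rho> < 1"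
  shows "pkernel \<rho> t s = cos (s + Arg (1 / (1 - of_real \<rho> * cis t))) / norm (1 - of_real \<rho> * cis t)"
proof -
  define w where "w = 1 / (1 - of_real \<rho> * cis t)"
  have "w = rcis (norm w) (Arg w)" by (simp add: rcis_cmod_Arg)
  then have "cis s * w = rcis (norm w) (s + Arg w)"
    by (metis cis_rcis_eq mult_1 rcis_mult)
  then have "Re (cis s * w) = norm w * cos (s + Arg w)" by simp
  then show ?thesis by (simp add: pkernel_def w_def norm_divide)
qed

lemma abs_pkernel_le:
  assumes \<rho>: "0 \<le> \<rho>" "\<rho> < 1"
  shows "\<bar>pkernel \<rho> t s\<bar> \<le> 1 / (1 - \<rho>)"
  unfolding pkernel_polar[OF \<rho>] abs_divide
  using norm_one_minus_rcis_ge[OF \<rho>(1), of t] \<rho> by (intro frac_le) auto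

lemma continuous_pkernel:
  assumes \<rho>: "0 \<le> \<rho>" "\<rho> < 1" and f: "continuous_on S f" and g: "continuous_on S g"
  shows "continuous_on S (\<lambda>x. pkernel \<rho> (f x) (g x))"
proof -
  have "1 - of_real \<rho> * cis t \<noteq> 0" for t
    using norm_one_minus_rcis_ge[OF \<rho>(1), of t] \<rho> by auto
  then show ?thesis
    unfolding pkernel_def cis_conv_exp using f g
    by (intro continuous_intros) (auto simp: cis_conv_exp)
qed

lemma pkernel_periodic:
  "pkernel \<rho> (t + 2 * pi) s = pkernel \<rho> t s" "pkernel \<rho> t (s + real_of_int k * (2 * pi)) = pkernel \<rho> t s"
proof -
  show "pkernel \<rho> (t + 2 * pi) s = pkernel \<rho> t s"
    by (simp add: pkernel_def cis.ctr)
  have "cis (s + real_of_int k * (2 * pi)) = cis s"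
    using periodic_2pi_int[of cos s k] periodic_2pi_int[of sin s k]
    by (simp add: complex_eq_iff periodic_2pi_def)
  then show "pkernel \<rho> t (s + real_of_int k * (2 * pi)) = pkernel \<rho> t s"
    by (simp add: pkernel_def)
qed

section \<open>The kernel with fast phase n t - \<gamma>\<close>

definition osc :: "real \<Rightarrow> nat \<Rightarrow> real \<Rightarrow> real \<Rightarrow> real" where
  "osc \<rho> n \<gamma> t = pkernel \<rho> t (real n * t - \<gamma>)"

lemma continuous_osc:
  assumes "0 \<le> \<rho>" "\<rho> < 1"
  shows "continuous_on UNIV (osc \<rho> n \<gamma>)"
  unfolding osc_def[abs_def] by (intro continuous_pkernel assms continuous_intros)

lemma periodic_osc: "periodic_2pi (osc \<rho> n \<gamma>)"
  unfolding periodic_2pi_def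
proof
  fix t
  have "real n * (t + 2 * pi) - \<gamma> = real n * t - \<gamma> + real_of_int (int n) * (2 * pi)"
    by (simp add: algebra_simps)
  then show "osc \<rho> n \<gamma> (t + 2 * pi) = osc \<rho> n \<gamma> t"
    unfolding osc_def by (simp only: pkernel_periodic)
qed

text \<open>Shifting \<open>t\<close> by v / n changes the fast phase by exactly \<open>v\<close>;
  only the slow variable is altered in addition, which the Lipschitz bound controls.\<close>

lemma osc_shift:
  assumes \<rho>: "0 \<le> \<rho>" "\<rho> < 1" and n: "1 \<le> n"
  shows "\<bar>osc \<rho> n \<gamma> (t + v / real n) - osc \<rho> n (\<gamma> - v) t\<bar> \<le> \<bar>v\<bar> / (real n * (1 - \<rho>)\<^sup>2)"
proof -
  have "real n * (t + v / real n) - \<gamma> = real n * t - (\<gamma> - v)" using n by (simp add: field_simps)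
  then have "\<bar>osc \<rho> n \<gamma> (t + v / real n) - osc \<rho> n (\<gamma> - v) t\<bar> \<le> \<bar>t + v / real n - t\<bar> / (1 - \<rho>)\<^sup>2"
    unfolding osc_def by (simp only: pkernel_lipschitz[OF \<rho>])
  then show ?thesis by (simp add: abs_divide)
qed

text \<open>The case v = -pi of \<open>osc_shift\<close>, where the change of phase is a change of
  sign. This is the near antisymmetry that the mean-zero construction requires.\<close>

lemma osc_half_shift:
  assumes \<rho>: "0 \<le> \<rho>" "\<rho> < 1" and n: "1 \<le> n"
  shows "\<bar>osc \<rho> n \<gamma> t + osc \<rho> n \<gamma> (t - pi / real n)\<bar> \<le> pi / (real n * (1 - \<rho>)\<^sup>2)"
proof -
  have "real n * t - (\<gamma> - - pi) + a = (real n * t - \<gamma> + a) - pi" for a by simp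
  then have "osc \<rho> n (\<gamma> - - pi) t = - osc \<rho> n \<gamma> t"
    unfolding osc_def pkernel_polar[OF \<rho>] by (simp only: cos_minus_pi minus_divide_left)
  then show ?thesis
    using osc_shift[OF assms, of \<gamma> t "-pi"] by (simp add: abs_minus_commute add.commute)
qed

text \<open>The shifted kernel has the same norm by periodicity and is uniformly close to the kernel
  of the other phase, so \<open>circ_norm_perturb\<close> applies in both directions.\<close>

lemma circ_norm_osc_phase:
  assumes \<rho>: "0 \<le> \<rho>" "\<rho> < 1" and n: "1 \<le> n" and q: "1 \<le> q" and v: "\<bar>v\<bar> \<le> pi"
  shows "\<bar>circ_norm q (osc \<rho> n (\<gamma> - v)) - circ_norm q (osc \<rho> n \<gamma>)\<bar> \<le> 2 * pi\<^sup>2 / (real n * (1 - \<rho>)\<^sup>2)"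
proof -
  define \<delta> where "\<delta> = pi / (real n * (1 - \<rho>)\<^sup>2)"
  define g where "g = (\<lambda>t. osc \<rho> n \<gamma> (t + v / real n))"
  have gn: "circ_norm q g = circ_norm q (osc \<rho> n \<gamma>)"
    unfolding g_def using q by (intro circ_norm_shift continuous_osc periodic_osc \<rho>) auto
  have gc: "continuous_on UNIV g"
    unfolding g_def by (intro continuous_on_compose2[OF continuous_osc[OF \<rho>]] continuous_intros) auto
  have d: "\<bar>g t - osc \<rho> n (\<gamma> - v) t\<bar> \<le> \<delta>" for t
  proof -
    have "\<bar>v\<bar> / (real n * (1 - \<rho>)\<^sup>2) \<le> \<delta>" unfolding \<delta>_def using v by (intro divide_right_mono) auto
    then show ?thesis unfolding g_def using osc_shift[OF \<rho> n, of \<gamma> t v] by linarith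
  qed
  have "circ_norm q g \<le> circ_norm q (osc \<rho> n (\<gamma> - v)) + 2 * pi * \<delta>"
    by (rule circ_norm_perturb[OF q continuous_osc[OF \<rho>] gc d])
  moreover have "circ_norm q (osc \<rho> n (\<gamma> - v)) \<le> circ_norm q g + 2 * pi * \<delta>"
    using d by (intro circ_norm_perturb[OF q gc continuous_osc[OF \<rho>]]) (simp add: abs_minus_commute)
  ultimately show ?thesis by (simp add: gn \<delta>_def abs_le_iff power2_eq_square mult.assoc)
qed

section \<open>Averaging over the phase\<close>

lemma integral_circ_swap:
  fixes f :: "real \<Rightarrow> real \<Rightarrow> real"
  assumes f: "continuous_on UNIV (\<lambda>(x, y). f x y)"
  shows "(\<integral>x. (\<integral>y. f x y \<partial>circ) \<partial>circ) = (\<integral>y. (\<integral>x. f x y \<partial>circ) \<partial>circ)"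
    and "continuous_on UNIV (\<lambda>x. \<integral>y. f x y \<partial>circ)"
proof -
  have hk: "(\<integral>x. g x \<partial>circ) = integral {-pi..pi} g" if "continuous_on UNIV g" for g :: "real \<Rightarrow> real"
    by (rule lebesgue_integral_eq_integral[OF integrable_circ_continuous[OF that]]) simp
  have f': "continuous_on UNIV (\<lambda>(x, y). f y x)"
    using continuous_on_compose2[OF f continuous_on_swap] by (simp add: case_prod_unfold prod.swap_def)
  have sec: "continuous_on UNIV (f x)" "continuous_on UNIV (\<lambda>x. f x y)" for x y
    by (rule continuous_on_compose2[OF f, of UNIV "\<lambda>y. (x, y)", simplified], intro continuous_intros)
       (rule continuous_on_compose2[OF f, of UNIV "\<lambda>x. (x, y)", simplified], intro continuous_intros)
  have p1: "continuous_on UNIV (\<lambda>x. integral {-pi..pi} (f x))"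
    using integral_continuous_on_param[of UNIV "-pi" pi f] continuous_on_subset[OF f] by auto
  have p2: "continuous_on UNIV (\<lambda>y. integral {-pi..pi} (\<lambda>x. f x y))"
    using integral_continuous_on_param[of UNIV "-pi" pi "\<lambda>y x. f x y"] continuous_on_subset[OF f'] by auto
  show "continuous_on UNIV (\<lambda>x. \<integral>y. f x y \<partial>circ)"
    using p1 by (simp add: hk[OF sec(1)])
  show "(\<integral>x. (\<integral>y. f x y \<partial>circ) \<partial>circ) = (\<integral>y. (\<integral>x. f x y \<partial>circ) \<partial>circ)"
    unfolding hk[OF sec(1)] hk[OF sec(2)] hk[OF p1] hk[OF p2]
    using integral_swap_continuous[of "-pi" "-pi" pi pi f] continuous_on_subset[OF f] by auto
qed

lemma continuous_on_cos_real: "continuous_on UNIV (cos :: real \<Rightarrow> real)"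
  by (intro continuous_intros)

text \<open>The mean of \<open>\<parallel>osc \<rho> n (\<gamma> - v)\<parallel>\<^sub>q\<^sup>q\<close> over all phases \<open>v\<close> can be computed exactly: after
  exchanging the integrals, the oscillating factor is integrated over a full period.\<close>

lemma phase_average:
  assumes \<rho>: "0 \<le> \<rho>" "\<rho> < 1" and q: "1 \<le> q"
  shows "(\<integral>v. circ_norm q (osc \<rho> n (\<gamma> - v)) powr q \<partial>circ)
      = 2 * pi * (circ_norm q cos * hypergeo_2F1 (q / 2) (q / 2) 1 (\<rho>\<^sup>2) powr (1 / q)) powr q"
    and "continuous_on UNIV (\<lambda>v. circ_norm q (osc \<rho> n (\<gamma> - v)) powr q)"
proof -
  define f where "f = (\<lambda>v t. \<bar>pkernel \<rho> t (real n * t - (\<gamma> - v))\<bar> powr q)"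
  have f: "continuous_on UNIV (\<lambda>(v, t). f v t)"
    unfolding f_def case_prod_unfold using q
    by (intro continuous_on_powr' continuous_intros continuous_pkernel \<rho>) auto
  have N: "circ_norm q (osc \<rho> n (\<gamma> - v)) powr q = (\<integral>t. f v t \<partial>circ)" for v
    using q by (simp add: circ_norm_powr f_def osc_def)
  show "continuous_on UNIV (\<lambda>v. circ_norm q (osc \<rho> n (\<gamma> - v)) powr q)"
    unfolding N by (rule integral_circ_swap(2)[OF f])
  \<comment> \<open>By the polar form the q-th power splits into |cos (v + c)|^q, whose integral
    over \<open>v\<close> is independent of \<open>c\<close>, and a factor depending on
    \<open>t\<close> only.\<close>
  have inner: "(\<integral>v. f v t \<partial>circ) = circ_norm q cos powr q * norm (1 - of_real \<rho> * cis t) powr (-q)" for t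
  proof -
    define c where "c = real n * t - \<gamma> + Arg (1 / (1 - of_real \<rho> * cis t))"
    define A where "A = norm (1 - of_real \<rho> * cis t)"
    have h: "(\<lambda>v. \<bar>cos v\<bar> powr q) \<in> borel_measurable lebesgue" "periodic_2pi (\<lambda>v. \<bar>cos v\<bar> powr q)"
      "integrable circ (\<lambda>v. \<bar>cos v\<bar> powr q)"
      using q continuous_measurable_lebesgue[OF continuous_abs_powr[OF continuous_on_cos_real]]
        integrable_circ_abs_powr[OF continuous_on_cos_real]
      by (simp_all add: periodic_2pi_def)
    have "f v t = A powr (-q) * \<bar>cos (v + c)\<bar> powr q" for v
    proof -
      have "real n * t - (\<gamma> - v) + Arg (1 / (1 - of_real \<rho> * cis t)) = v + c" by (simp add: c_def)
      then have "f v t = \<bar>cos (v + c) / A\<bar> powr q"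
        unfolding f_def pkernel_polar[OF \<rho>] A_def by (simp only:)
      then show ?thesis
        by (simp add: A_def abs_divide powr_divide powr_minus_divide)
    qed
    then have "(\<integral>v. f v t \<partial>circ) = A powr (-q) * (\<integral>v. \<bar>cos (v + c)\<bar> powr q \<partial>circ)" by simp
    also have "(\<integral>v. \<bar>cos (v + c)\<bar> powr q \<partial>circ) = circ_norm q cos powr q"
      using integral_circ_shift[OF h, of c] q by (simp add: circ_norm_powr)
    finally show ?thesis by (simp add: A_def)
  qed
  define H where "H = hypergeo_2F1 (q / 2) (q / 2) 1 (\<rho>\<^sup>2)"
  \<comment> \<open>Besides its value, the integral yields \<open>H \<ge> 0\<close>, without which
    the q-th power would not undo the root of \<open>H\<close>.\<close>
  have I: "(\<integral>t. norm (1 - of_real \<rho> * cis t) powr (-q) \<partial>circ) = 2 * pi * H"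
    unfolding H_def using q by (intro integral_hypergeo \<rho>) auto
  have "0 \<le> (\<integral>t. norm (1 - of_real \<rho> * cis t) powr (-q) \<partial>circ)" by (simp add: integral_nonneg_AE)
  then have H0: "0 \<le> H" unfolding I using pi_gt_zero by (simp add: zero_le_mult_iff not_le[symmetric])
  have "(\<integral>v. circ_norm q (osc \<rho> n (\<gamma> - v)) powr q \<partial>circ) = (\<integral>t. (\<integral>v. f v t \<partial>circ) \<partial>circ)"
    unfolding N by (rule integral_circ_swap(1)[OF f])
  also have "\<dots> = circ_norm q cos powr q * (2 * pi * H)"
    unfolding inner using I by simp
  also have "\<dots> = 2 * pi * (circ_norm q cos * H powr (1 / q)) powr q"
    using q H0 by (simp add: powr_mult powr_powr circ_norm_nonneg)
  finally show "(\<integral>v. circ_norm q (osc \<rho> n (\<gamma> - v)) powr q \<partial>circ)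
      = 2 * pi * (circ_norm q cos * hypergeo_2F1 (q / 2) (q / 2) 1 (\<rho>\<^sup>2) powr (1 / q)) powr q"
    unfolding H_def .
qed

text \<open>All phases have norms within \<eta> of \<open>N\<close>, and the q-th powers of these
  norms average to T^q. Hence \<open>T\<close> lies within \<eta> of \<open>N\<close>, with no loss
  depending on \<open>q\<close>.\<close>

lemma circ_norm_osc_approx:
  assumes \<rho>: "0 \<le> \<rho>" "\<rho> < 1" and n: "1 \<le> n" and q: "1 \<le> q"
  shows "\<bar>circ_norm q (osc \<rho> n \<gamma>) - circ_norm q cos * hypergeo_2F1 (q / 2) (q / 2) 1 (\<rho>\<^sup>2) powr (1 / q)\<bar>
    \<le> 2 * pi\<^sup>2 / (real n * (1 - \<rho>)\<^sup>2)"
proof -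
  define \<eta> where "\<eta> = 2 * pi\<^sup>2 / (real n * (1 - \<rho>)\<^sup>2)"
  define T where "T = circ_norm q cos * hypergeo_2F1 (q / 2) (q / 2) 1 (\<rho>\<^sup>2) powr (1 / q)"
  define N where "N = circ_norm q (osc \<rho> n \<gamma>)"
  define w where "w = (\<lambda>v. circ_norm q (osc \<rho> n (\<gamma> - v)))"
  have \<eta>0: "0 \<le> \<eta>" by (simp add: \<eta>_def)
  have T0: "0 \<le> T" by (simp add: T_def circ_norm_nonneg)
  have N0: "0 \<le> N" "0 \<le> w v" for v by (simp_all add: N_def w_def circ_norm_nonneg)
  have w: "\<bar>w v - N\<bar> \<le> \<eta>" if "v \<in> space circ" for v
    unfolding w_def N_def \<eta>_def using that by (intro circ_norm_osc_phase \<rho> n q) auto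
  have avg: "(\<integral>v. w v powr q \<partial>circ) = 2 * pi * T powr q"
    unfolding w_def T_def by (rule phase_average[OF \<rho> q])
  have wi: "integrable circ (\<lambda>v. w v powr q)"
    unfolding w_def by (rule integrable_circ_continuous[OF phase_average(2)[OF \<rho> q]])
  have root: "x \<le> y" if "x powr q \<le> y powr q" "0 \<le> y" for x y
  proof (rule ccontr)
    assume "\<not> x \<le> y"
    then have "y powr q < x powr q" using that(2) q by (intro powr_less_mono2) auto
    with that(1) show False by simp
  qed
  have "(\<integral>v. w v powr q \<partial>circ) \<le> (\<integral>v. (N + \<eta>) powr q \<partial>circ)"
  proof (rule integral_mono)
    fix v assume "v \<in> space circ"
    from w[OF this] show "w v powr q \<le> (N + \<eta>) powr q"
      using q N0 by (intro powr_mono2) auto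
  qed (use wi in auto)
  then have "T powr q \<le> (N + \<eta>) powr q" unfolding avg by simp
  then have 1: "T \<le> N + \<eta>" using root[of T "N + \<eta>"] N0 \<eta>0 by simp
  have 2: "N - \<eta> \<le> T"
  \<comment> \<open>Taking q-th powers is monotone on nonnegative numbers only; for a nonpositive
    left side the bound is trivial.\<close>
  proof (cases "N - \<eta> \<le> 0")
    case False
    have "(\<integral>v. (N - \<eta>) powr q \<partial>circ) \<le> (\<integral>v. w v powr q \<partial>circ)"
    proof (rule integral_mono)
      fix v assume "v \<in> space circ"
      from w[OF this] show "(N - \<eta>) powr q \<le> w v powr q"
        using q False by (intro powr_mono2) auto
    qed (use wi in auto)
    then have "(N - \<eta>) powr q \<le> T powr q" unfolding avg by simp
    then show ?thesis using root[of "N - \<eta>" T] T0 by simp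
  qed (use T0 in linarith)
  show ?thesis using 1 2 unfolding N_def[symmetric] T_def[symmetric] \<eta>_def[symmetric] by (simp add: abs_le_iff)
qed

subsection \<open>Approximating the remainder of the Weyl--Nagy kernel\<close>

text \<open>Bernoulli's inequality with real exponent a = r / m, raised to the power
  \<open>m\<close>. It comes from the weighted arithmetic-geometric mean inequality for 1 + a x and
  1 with weights 1 / a and 1 - 1 / a.\<close>

lemma bernoulli_powr:
  fixes x r m :: real
  assumes "0 \<le> x" "0 < m" "m \<le> r"
  shows "(1 + r * x / m) powr m \<le> (1 + x) powr r"
proof -
  define a where "a = r / m"
  have a: "1 \<le> a" using assms by (simp add: a_def)
  have "1 + a * x \<le> (1 + x) powr a"
  proof -
    have ax: "0 \<le> a * x" using a assms by simp
    have "(1 + a * x) powr (1 / a) \<le> 1 + x"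
    proof -
      have "(1 + a * x) powr (1 / a) * 1 powr (1 - 1 / a) \<le> 1 / a * (1 + a * x) + (1 - 1 / a) * 1"
        using a ax by (intro Youngs_inequality_0) auto
      moreover have "1 / a * (1 + a * x) + (1 - 1 / a) * 1 = 1 + x"
        using a by (simp add: field_simps)
      ultimately show ?thesis by simp
    qed
    then have "((1 + a * x) powr (1 / a)) powr a \<le> (1 + x) powr a"
      using a by (intro powr_mono2) auto
    then show ?thesis using a ax by (simp add: powr_powr)
  qed
  then have "(1 + a * x) powr m \<le> ((1 + x) powr a) powr m"
    using assms a by (intro powr_mono2) (auto simp: add_nonneg_nonneg)
  also have "\<dots> = (1 + x) powr r" using assms by (simp add: powr_powr a_def)
  finally show ?thesis by (simp add: a_def mult.commute)
qed

text \<open>The factor 1 / r and the quadratic decay are both needed: summed over x = k / n they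
  give the order n / r^2. For r >= 4 the gain comes from x - ln (1 + x) <= x^2; for smaller
  \<open>r\<close> the factor 1 / r is just a constant.\<close>

lemma coefficient_diff_bound:
  fixes r x :: real
  assumes r: "2 \<le> r" and x: "0 \<le> x"
  shows "\<bar>(1 + x) powr (-r) - exp (- r * x)\<bar> \<le> 16 / r * (1 / (1 + r * x / 4)\<^sup>2)"
proof -
  define d where "d = (1 + x) powr (-r)"
  have "0 < 1 + x" using x by linarith
  then have d0: "0 < d" by (simp add: d_def)
  have d_exp: "d = exp (- (r * ln (1 + x)))" using x by (simp add: d_def powr_def)
  have "ln (1 + x) \<le> x" using x by (rule ln_add_one_self_le_self)
  then have "r * ln (1 + x) \<le> r * x" using r by simp
  then have le: "exp (- r * x) \<le> d" by (simp add: d_exp)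
  have "0 \<le> r * x" using r x by simp
  then have pos: "1 \<le> 1 + r * x / 4" "0 < (1 + r * x / 4)\<^sup>2" by auto
  have "d - exp (- r * x) \<le> 16 / r * (1 / (1 + r * x / 4)\<^sup>2)"
  proof (cases "r < 4")
    case True
    \<comment> \<open>Here 16 / r exceeds 1, so the exponential may simply be dropped from the
      difference.\<close>
    have "(1 + r * x / 2)\<^sup>2 \<le> (1 + x) powr r"
      using bernoulli_powr[of x 2 r] r x by (simp add: add_nonneg_pos)
    moreover have "(1 + r * x / 4)\<^sup>2 \<le> (1 + r * x / 2)\<^sup>2"
      using \<open>0 \<le> r * x\<close> by (intro power_mono) auto
    ultimately have "(1 + r * x / 4)\<^sup>2 \<le> (1 + x) powr r" by linarith
    then have "d \<le> 1 / (1 + r * x / 4)\<^sup>2"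
      unfolding d_def powr_minus_divide using pos by (intro frac_le) auto
    also have "\<dots> \<le> 16 / r * (1 / (1 + r * x / 4)\<^sup>2)"
      using True r pos by (simp add: field_simps)
    finally show ?thesis using exp_ge_zero[of "- r * x"] by linarith
  next
    case False
    have "- ln (1 + x) \<le> 1 / (1 + x) - 1"
      using ln_le_minus_one[of "1 / (1 + x)"] x by (simp add: ln_div)
    then have "x - ln (1 + x) \<le> x\<^sup>2 / (1 + x)"
      using x by (simp add: field_simps power2_eq_square)
    also have "\<dots> \<le> x\<^sup>2" using x by (simp add: divide_le_eq mult_le_cancel_left1)
    finally have l: "x - ln (1 + x) \<le> x\<^sup>2" .
    have "d - exp (- r * x) = d * (1 - exp (- (r * (x - ln (1 + x)))))"
      by (simp add: d_exp algebra_simps flip: exp_add)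
    also have "\<dots> \<le> d * (r * (x - ln (1 + x)))"
      using d0 exp_ge_add_one_self[of "- (r * (x - ln (1 + x)))"] by (intro mult_left_mono) auto
    also have "\<dots> \<le> d * (r * x\<^sup>2)"
      using d0 r l by (intro mult_left_mono) auto
    \<comment> \<open>Fourth-order decay is available since r >= 4; two of the four orders absorb r
      x^2, and the other two remain.\<close>
    also have "\<dots> \<le> 1 / (1 + r * x / 4) ^ 4 * (r * x\<^sup>2)"
    proof (rule mult_right_mono)
      have "(1 + r * x / 4) ^ 4 \<le> (1 + x) powr r"
        using bernoulli_powr[of x 4 r] r x False pos by simp
      then show "d \<le> 1 / (1 + r * x / 4) ^ 4"
        unfolding d_def powr_minus_divide using pos by (intro frac_le) auto
    qed (use r in simp)
    also have "\<dots> \<le> 1 / (1 + r * x / 4) ^ 4 * (16 / r * (1 + r * x / 4)\<^sup>2)"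
    proof (rule mult_left_mono)
      have "(r * x / 4)\<^sup>2 \<le> (1 + r * x / 4)\<^sup>2"
        using \<open>0 \<le> r * x\<close> by (intro power_mono) auto
      then have "16 / r * (r * x / 4)\<^sup>2 \<le> 16 / r * (1 + r * x / 4)\<^sup>2"
        using r by (intro mult_left_mono) auto
      moreover have "16 / r * (r * x / 4)\<^sup>2 = r * x\<^sup>2"
        using r by (simp add: power2_eq_square)
      ultimately show "r * x\<^sup>2 \<le> 16 / r * (1 + r * x / 4)\<^sup>2" by simp
    qed (use pos in simp)
    also have "\<dots> = 16 / r * (1 / (1 + r * x / 4)\<^sup>2)"
    proof -
      have "1 / u ^ 4 * (c * u\<^sup>2) = c * (1 / u\<^sup>2)" if "0 < u" for u c :: real
        using that by (simp add: field_simps power2_eq_square power4_eq_xxxx)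
      then show ?thesis using pos by simp
    qed
    finally show ?thesis .
  qed
  then show ?thesis using le unfolding d_def[symmetric] by (simp add: abs_of_nonneg)
qed

text \<open>Comparison with a telescoping sum of u k = 1 / (1 + k y). The factor 2 replaces one
  factor 1 + k y by 1 + (k + 1) y, which is at most twice as large because y <= 1.\<close>

lemma sum_inverse_squares_bound:
  fixes y :: real
  assumes y: "0 < y" "y \<le> 1"
  shows "summable (\<lambda>k. 1 / (1 + real k * y)\<^sup>2)" "(\<Sum>k. 1 / (1 + real k * y)\<^sup>2) \<le> 2 / y"
proof -
  define u where "u = (\<lambda>k. 1 / (1 + real k * y))"
  have le: "1 / (1 + real k * y)\<^sup>2 \<le> 2 / y * (u k - u (Suc k))" for k
  proof -
    have ky: "0 \<le> real k * y" using y by simp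
    have "2 / y * (u k - u (Suc k)) = 2 / ((1 + real k * y) * (1 + real (Suc k) * y))"
    proof -
      have "1 / a - 1 / (a + y) = y / (a * (a + y))" if "0 < a" for a
        using that y by (simp add: field_simps)
      moreover have "1 + real (Suc k) * y = 1 + real k * y + y" by (simp add: algebra_simps)
      moreover have "0 < 1 + real k * y" using ky by linarith
      ultimately have "u k - u (Suc k) = y / ((1 + real k * y) * (1 + real (Suc k) * y))"
        by (simp only: u_def)
      then show ?thesis using y by simp
    qed
    moreover have "1 / (1 + real k * y)\<^sup>2 = 2 / ((1 + real k * y) * (2 * (1 + real k * y)))"
      by (simp only: power2_eq_square mult.left_commute[of _ 2] mult_divide_mult_cancel_left_if) simp
    moreover have "2 / ((1 + real k * y) * (2 * (1 + real k * y))) \<le> 2 / ((1 + real k * y) * (1 + real (Suc k) * y))"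
    proof -
      have suc: "real (Suc k) * y = real k * y + y" by (simp add: algebra_simps)
      have "0 < 1 + z \<and> 0 < 1 + (z + y) \<and> 1 + (z + y) \<le> 2 * (1 + z)" if "0 \<le> z" for z
        using that y by auto
      from this[OF ky] have "0 < 1 + real k * y" "0 < 1 + real (Suc k) * y"
          "1 + real (Suc k) * y \<le> 2 * (1 + real k * y)"
        unfolding suc by blast+
      then show ?thesis by (intro divide_left_mono mult_left_mono mult_pos_pos) auto
    qed
    ultimately show ?thesis by simp
  qed
  have partial: "(\<Sum>k<N. 1 / (1 + real k * y)\<^sup>2) \<le> 2 / y" for N
  proof -
    have "(\<Sum>k<N. 1 / (1 + real k * y)\<^sup>2) \<le> (\<Sum>k<N. 2 / y * (u k - u (Suc k)))"
      by (rule sum_mono[OF le])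
    also have "\<dots> = 2 / y * (u 0 - u N)"
      by (simp only: sum_distrib_left[symmetric] sum_lessThan_telescope')
    also have "\<dots> \<le> 2 / y * 1"
      using y by (intro mult_left_mono) (auto simp: u_def)
    finally show ?thesis by simp
  qed
  show sm: "summable (\<lambda>k. 1 / (1 + real k * y)\<^sup>2)"
    by (rule summableI_nonneg_bounded[OF _ partial]) simp
  show "(\<Sum>k. 1 / (1 + real k * y)\<^sup>2) \<le> 2 / y"
    by (rule suminf_le_const[OF sm partial])
qed

lemma osc_sums:
  assumes \<rho>: "0 \<le> \<rho>" "\<rho> < 1"
  shows "(\<lambda>k. \<rho> ^ k * cos (real (n + k) * t - \<gamma>)) sums osc \<rho> n \<gamma> t"
proof -
  have "norm (of_real \<rho> * cis t) < 1" using \<rho> by (simp add: norm_mult)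
  from sums_mult[OF geometric_sums[OF this], of "cis (real n * t - \<gamma>)"]
  have "(\<lambda>k. Re (cis (real n * t - \<gamma>) * (of_real \<rho> * cis t) ^ k)) sums osc \<rho> n \<gamma> t"
    unfolding osc_def pkernel_def by (intro sums_Re) simp
  moreover have "Re (cis (real n * t - \<gamma>) * (of_real \<rho> * cis t) ^ k) = \<rho> ^ k * cos (real (n + k) * t - \<gamma>)" for k
  proof -
    have "cis (real n * t - \<gamma>) * (of_real \<rho> * cis t) ^ k
        = of_real (\<rho> ^ k) * (cis (real n * t - \<gamma>) * cis (real k * t))"
      by (simp add: power_mult_distrib Complex.DeMoivre)
    also have "cis (real n * t - \<gamma>) * cis (real k * t) = cis (real (n + k) * t - \<gamma>)"
      by (simp add: cis_mult algebra_simps)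
    finally show ?thesis by simp
  qed
  ultimately show ?thesis by simp
qed

text \<open>The Weyl-Nagy kernel from harmonic \<open>n\<close> on, divided by
  \<open>n powr (-r)\<close>.\<close>

definition tail_kernel :: "real \<Rightarrow> nat \<Rightarrow> real \<Rightarrow> real \<Rightarrow> real" where
  "tail_kernel r n \<gamma> t = (\<Sum>k. (1 + real k / real n) powr (-r) * cos (real (n + k) * t - \<gamma>))"

section \<open>Uniform estimates for the tail kernel in the given range of r and n\<close>

locale parameters =
  fixes r \<gamma> :: real and n :: nat
  assumes n: "1 \<le> n" and r: "sqrt (real n) + 1 \<le> r" "r \<le> real n + 1"
begin

definition "\<rho> = exp (- r / real n)"
definition "\<delta> = real n / r\<^sup>2"
abbreviation "D \<equiv> tail_kernel r n \<gamma>"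

lemma r2: "2 \<le> r"
proof -
  have "1 \<le> sqrt (real n)" using n by simp
  with r show ?thesis by linarith
qed

lemma \<rho>: "0 \<le> \<rho>" "\<rho> < 1"
  using n r2 by (auto simp: \<rho>_def)

lemma \<delta>_pos: "0 < \<delta>"
  using n r2 by (simp add: \<delta>_def)

text \<open>With u = r / n, the bound r <= n + 1 <= 2 n gives u <= 2, hence 1 - e^(-u) >= u / (1 +
  u) >= u / 3. Squaring produces the constant 9.\<close>

lemma one_minus_\<rho>: "1 / (real n * (1 - \<rho>)\<^sup>2) \<le> 9 * \<delta>"
proof -
  define u where "u = r / real n"
  have u: "0 < u" "u \<le> 2" using n r r2 by (auto simp: u_def field_simps)
  have "1 + u \<le> exp u" by (rule exp_ge_add_one_self)
  then have "\<rho> \<le> 1 / (1 + u)"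
    using u by (simp add: \<rho>_def u_def[symmetric] exp_minus field_simps)
  moreover have "1 - 1 / (1 + u) = u / (1 + u)" using u by (simp add: field_simps)
  moreover have "u / 3 \<le> u / (1 + u)" using u by (intro divide_left_mono) auto
  ultimately have "u / 3 \<le> 1 - \<rho>" by linarith
  then have "(u / 3)\<^sup>2 \<le> (1 - \<rho>)\<^sup>2" using u by (intro power_mono) auto
  then have "1 / (real n * (1 - \<rho>)\<^sup>2) \<le> 1 / (real n * (u / 3)\<^sup>2)"
    using n u by (intro frac_le mult_left_mono mult_pos_pos) auto
  also have "\<dots> = 9 * \<delta>" using n r2 by (simp add: u_def \<delta>_def power2_eq_square field_simps)
  finally show ?thesis .
qed

lemma coefficients_summable: "summable (\<lambda>k. \<bar>(1 + real k / real n) powr (-r) - \<rho> ^ k\<bar>)"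
  and coefficients_sum: "(\<Sum>k. \<bar>(1 + real k / real n) powr (-r) - \<rho> ^ k\<bar>) \<le> 128 * \<delta>"
proof -
  \<comment> \<open>With this \<open>y\<close> the decay in \<open>coefficient_diff_bound\<close> at
    x = k / n is 1 / (1 + k y)^2, and 128 is 16 times the 8 from 2 / y = 8 n / r.\<close>
  define y where "y = r / (4 * real n)"
  have y: "0 < y" "y \<le> 1" using n r r2 by (auto simp: y_def field_simps)
  have b: "\<bar>(1 + real k / real n) powr (-r) - \<rho> ^ k\<bar> \<le> 16 / r * (1 / (1 + real k * y)\<^sup>2)" for k
  proof -
    have "\<rho> ^ k = exp (- r * (real k / real n))"
      by (simp add: \<rho>_def flip: exp_of_nat_mult)
    moreover have "r * (real k / real n) / 4 = real k * y" by (simp add: y_def mult_ac)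
    ultimately show ?thesis
      using coefficient_diff_bound[OF r2, of "real k / real n"] by simp
  qed
  note s = sum_inverse_squares_bound[OF y]
  have s1: "summable (\<lambda>k. 16 / r * (1 / (1 + real k * y)\<^sup>2))" by (rule summable_mult[OF s(1)])
  show sm: "summable (\<lambda>k. \<bar>(1 + real k / real n) powr (-r) - \<rho> ^ k\<bar>)"
    by (rule summable_comparison_test'[OF s1]) (use b in auto)
  have "(\<Sum>k. \<bar>(1 + real k / real n) powr (-r) - \<rho> ^ k\<bar>) \<le> (\<Sum>k. 16 / r * (1 / (1 + real k * y)\<^sup>2))"
    by (rule suminf_le[OF b sm s1])
  also have "\<dots> = 16 / r * (\<Sum>k. 1 / (1 + real k * y)\<^sup>2)" by (rule suminf_mult[OF s(1)])
  also have "\<dots> \<le> 16 / r * (2 / y)" using r2 by (intro mult_left_mono s(2)) auto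
  also have "\<dots> = 128 * \<delta>" using n r2 by (simp add: y_def \<delta>_def power2_eq_square)
  finally show "(\<Sum>k. \<bar>(1 + real k / real n) powr (-r) - \<rho> ^ k\<bar>) \<le> 128 * \<delta>" .
qed

lemma tail_coefficients_summable: "summable (\<lambda>k. \<bar>(1 + real k / real n) powr (-r)\<bar>)"
proof -
  have "summable (\<lambda>k. \<bar>(1 + real k / real n) powr (-r) - \<rho> ^ k\<bar> + \<rho> ^ k)"
    using \<rho> by (intro summable_add coefficients_summable summable_geometric) simp
  then show ?thesis
    by (rule summable_comparison_test'[where N = 0]) (use \<rho> in \<open>auto simp: abs_if zero_le_power\<close>)
qed

lemma continuous_D: "continuous_on UNIV D"
  unfolding tail_kernel_def[abs_def]
  by (rule continuous_series[OF tail_coefficients_summable]) (auto intro!: continuous_intros)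

lemma periodic_D: "periodic_2pi D"
  unfolding periodic_2pi_def
proof
  fix t
  have "cos (real (n + k) * (t + 2 * pi) - \<gamma>) = cos (real (n + k) * t - \<gamma>)" for k
  proof -
    have "real (n + k) * (t + 2 * pi) - \<gamma> = real (n + k) * t - \<gamma> + of_int (int (n + k)) * (2 * pi)"
      by (simp add: algebra_simps)
    moreover have "periodic_2pi cos" by (simp add: periodic_2pi_def)
    ultimately show ?thesis by (simp only: periodic_2pi_int)
  qed
  then show "D (t + 2 * pi) = D t" by (simp add: tail_kernel_def)
qed

lemma D_osc: "\<bar>D t - osc \<rho> n \<gamma> t\<bar> \<le> 128 * \<delta>"
proof -
  define e where "e = (\<lambda>k. cos (real (n + k) * t - \<gamma>))"
  have e: "\<bar>e k\<bar> \<le> 1" for k by (simp add: e_def)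
  have sD: "summable (\<lambda>k. (1 + real k / real n) powr (-r) * e k)"
    by (rule summable_rabs_cancel[OF summable_bounded_terms[OF tail_coefficients_summable e]])
  note so = osc_sums[OF \<rho>, of n t \<gamma>, folded e_def]
  have "D t - osc \<rho> n \<gamma> t = (\<Sum>k. (1 + real k / real n) powr (-r) * e k - \<rho> ^ k * e k)"
    using suminf_diff[OF sD sums_summable[OF so]] so
    by (simp add: tail_kernel_def e_def sums_iff)
  also have "\<dots> = (\<Sum>k. ((1 + real k / real n) powr (-r) - \<rho> ^ k) * e k)"
    by (simp add: left_diff_distrib)
  finally have *: "D t - osc \<rho> n \<gamma> t = (\<Sum>k. ((1 + real k / real n) powr (-r) - \<rho> ^ k) * e k)" .
  have sa: "summable (\<lambda>k. \<bar>((1 + real k / real n) powr (-r) - \<rho> ^ k) * e k\<bar>)"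
    by (rule summable_bounded_terms[OF coefficients_summable e])
  have "\<bar>D t - osc \<rho> n \<gamma> t\<bar> \<le> (\<Sum>k. \<bar>((1 + real k / real n) powr (-r) - \<rho> ^ k) * e k\<bar>)"
    unfolding * by (rule summable_rabs[OF sa])
  also have "\<dots> \<le> (\<Sum>k. \<bar>(1 + real k / real n) powr (-r) - \<rho> ^ k\<bar>)"
    by (rule suminf_le[OF _ sa coefficients_summable]) (use e in \<open>simp add: abs_mult mult_left_le\<close>)
  also note coefficients_sum
  finally show ?thesis .
qed

text \<open>Two replacements of \<open>D\<close> by \<open>osc\<close> cost 128 \<delta> each, and
  the half shift of \<open>osc\<close> costs 9 pi \<delta>.\<close>

lemma D_half_shift: "\<bar>D t + D (t - pi / real n)\<bar> \<le> (256 + 9 * pi) * \<delta>"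
proof -
  have "pi * (1 / (real n * (1 - \<rho>)\<^sup>2)) \<le> pi * (9 * \<delta>)"
    by (intro mult_left_mono one_minus_\<rho>) simp
  then have "\<bar>osc \<rho> n \<gamma> t + osc \<rho> n \<gamma> (t - pi / real n)\<bar> \<le> 9 * pi * \<delta>"
    using osc_half_shift[OF \<rho> n, of \<gamma> t] by simp
  then show ?thesis
    using D_osc[of t] D_osc[of "t - pi / real n"] by (simp add: algebra_simps abs_le_iff)
qed

lemma circ_norm_D:
  assumes q: "1 \<le> q"
  shows "\<bar>circ_norm q D - circ_norm q cos * hypergeo_2F1 (q / 2) (q / 2) 1 (\<rho>\<^sup>2) powr (1 / q)\<bar>
    \<le> (256 * pi + 18 * pi\<^sup>2) * \<delta>"
proof -
  note c = continuous_D continuous_osc[OF \<rho>, of n \<gamma>]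
  have "circ_norm q D \<le> circ_norm q (osc \<rho> n \<gamma>) + 2 * pi * (128 * \<delta>)"
    using D_osc by (intro circ_norm_perturb[OF q c(2,1)])
  moreover have "circ_norm q (osc \<rho> n \<gamma>) \<le> circ_norm q D + 2 * pi * (128 * \<delta>)"
    using D_osc by (intro circ_norm_perturb[OF q c(1,2)]) (simp add: abs_minus_commute)
  moreover have "2 * pi\<^sup>2 * (1 / (real n * (1 - \<rho>)\<^sup>2)) \<le> 2 * pi\<^sup>2 * (9 * \<delta>)"
    by (intro mult_left_mono one_minus_\<rho>) simp
  ultimately show ?thesis
    using circ_norm_osc_approx[OF \<rho> n q, of \<gamma>] by (simp add: algebra_simps abs_le_iff)
qed

lemma D_le: "\<bar>D t\<bar> \<le> 1 / (1 - \<rho>) + 128 * \<delta>"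
  using D_osc[of t] abs_pkernel_le[OF \<rho>, of t "real n * t - \<gamma>"] unfolding osc_def by linarith

text \<open>The peak 1 / (1 - \<rho>) occurs at slow variable 0 and fast phase 0. A point with |t|
  <= pi / n has fast phase 0 modulo 2 pi, and moving the slow variable there from 0 costs at most 9
  pi \<delta>.\<close>

lemma D_large: "\<exists>t. 1 / (1 - \<rho>) - (129 + 9 * pi) * \<delta> < D t"
proof -
  define k where "k = \<lfloor>(\<gamma> + pi) / (2 * pi)\<rfloor>"
  have k: "of_int k \<le> (\<gamma> + pi) / (2 * pi)" "(\<gamma> + pi) / (2 * pi) < of_int k + 1"
    unfolding k_def by linarith+
  define v where "v = \<gamma> - of_int k * (2 * pi)"
  define t where "t = v / real n"
  have v: "\<bar>v\<bar> \<le> pi" using k by (auto simp: v_def field_simps abs_le_iff)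
  have "real n * t - \<gamma> = 0 + real_of_int (- k) * (2 * pi)"
    using n by (simp add: t_def v_def)
  then have "osc \<rho> n \<gamma> t = pkernel \<rho> t 0"
    unfolding osc_def by (simp only: pkernel_periodic)
  moreover have "pkernel \<rho> 0 0 = 1 / (1 - \<rho>)"
  proof -
    have e: "1 - of_real \<rho> * cis 0 = of_real (1 - \<rho>)" by simp
    show ?thesis unfolding pkernel_def e Re_divide_of_real by simp
  qed
  moreover have "\<bar>pkernel \<rho> t 0 - pkernel \<rho> 0 0\<bar> \<le> 9 * pi * \<delta>"
  proof -
    have "\<bar>pkernel \<rho> t 0 - pkernel \<rho> 0 0\<bar> \<le> \<bar>v\<bar> * (1 / (real n * (1 - \<rho>)\<^sup>2))"
      using pkernel_lipschitz[OF \<rho>, of t 0 0] by (simp add: t_def abs_divide)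
    also have "\<dots> \<le> pi * (9 * \<delta>)"
      using v by (intro mult_mono one_minus_\<rho>) auto
    finally show ?thesis by simp
  qed
  \<comment> \<open>One \<delta> more than the 128 of \<open>D_osc\<close> makes the inequality
    strict, as \<open>exists_extremal_1\<close> demands.\<close>
  ultimately have "1 / (1 - \<rho>) - (129 + 9 * pi) * \<delta> < D t"
    using D_osc[of t] \<delta>_pos by (simp add: algebra_simps abs_le_iff)
  then show ?thesis ..
qed

end

subsection \<open>The approximation error\<close>

lemma ereal_real_of_ereal_between:
  fixes v :: ereal
  assumes "ereal a \<le> v" "v \<le> ereal b"
  obtains x where "v = ereal x" "a \<le> x" "x \<le> b"
  using assms by (cases v) auto

context parameters
begin

lemma kernel_coefficients_summable: "summable (\<lambda>k. \<bar>real (Suc k) powr (-r)\<bar>)"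
proof -
  have "summable (\<lambda>k. real k powr (-r))" using r2 by (simp add: summable_real_powr_iff)
  then show ?thesis by (subst (asm) summable_Suc_iff[symmetric]) simp
qed

lemma remainder_eq:
  assumes p: "1 \<le> p" and \<phi>: "\<phi> \<in> Bp0 p" and \<gamma>: "\<gamma> = \<beta> * pi / 2"
    and f: "\<And>x. f x = a0 / 2 + 1 / pi * (LINT t:{-pi..pi}|lebesgue. \<phi> (x - t) * weyl_nagy_kernel r \<beta> t)"
  shows "f x - fourier_sum (n - 1) f x = real n powr (-r) / pi * (\<integral>t. \<phi> (x - t) * D t \<partial>circ)"
proof -
  note B = Bp0D[OF \<phi>]
  have "f x - fourier_sum (n - 1) f x = 1 / pi * (\<integral>t. \<phi> (x - t) *
      (\<Sum>k. real (Suc (k + (n - 1))) powr (-r) * cos (real (Suc (k + (n - 1))) * t - \<gamma>)) \<partial>circ)"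
    using integrable_unit_ball[OF p B(1,3)] f
    by (intro convolution_remainder[OF B(1,2) _ kernel_coefficients_summable, where ?a0.0 = a0])
       (simp_all add: set_LINT_circ weyl_nagy_kernel_def \<gamma>)
  also have "(\<lambda>t. \<Sum>k. real (Suc (k + (n - 1))) powr (-r) * cos (real (Suc (k + (n - 1))) * t - \<gamma>))
      = (\<lambda>t. real n powr (-r) * D t)"
  proof
    fix t
    have "real (Suc (k + (n - 1))) powr (-r) * cos (real (Suc (k + (n - 1))) * t - \<gamma>)
        = real n powr (-r) * ((1 + real k / real n) powr (-r) * cos (real (n + k) * t - \<gamma>))" for k
    proof -
      \<comment> \<open>The sum of order n - 1 leaves the harmonics from \<open>n\<close> on;
        natural subtraction is harmless because n >= 1.\<close>
      have "Suc (k + (n - 1)) = n + k" using n by simp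
      moreover have "real (n + k) = real n * (1 + real k / real n)" using n by (simp add: field_simps)
      then have "real (n + k) powr (-r) = real n powr (-r) * (1 + real k / real n) powr (-r)"
        by (simp only: powr_mult)
      ultimately show ?thesis by (simp only: mult.assoc)
    qed
    moreover have "summable (\<lambda>k. (1 + real k / real n) powr (-r) * cos (real (n + k) * t - \<gamma>))"
      by (rule summable_rabs_cancel[OF summable_bounded_terms[OF tail_coefficients_summable, where C = 1]]) simp
    ultimately show "(\<Sum>k. real (Suc (k + (n - 1))) powr (-r) * cos (real (Suc (k + (n - 1))) * t - \<gamma>))
      = real n powr (-r) * D t"
      by (simp only: suminf_mult tail_kernel_def)
  qed
  then have "(\<integral>t. \<phi> (x - t) *
      (\<Sum>k. real (Suc (k + (n - 1))) powr (-r) * cos (real (Suc (k + (n - 1))) * t - \<gamma>)) \<partial>circ)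
      = (\<integral>t. real n powr (-r) * (\<phi> (x - t) * D t) \<partial>circ)"
    by (simp only: fun_eq_iff mult.left_commute)
  finally show ?thesis by simp
qed

lemma continuous_D_reflect: "continuous_on UNIV (\<lambda>t. D (x - t))"
  by (intro continuous_on_compose2[OF continuous_D] continuous_intros) auto

text \<open>Reduces the supremum over the class to bounds for integrals against \<open>D\<close>.
  The upper bound \<open>U\<close> must hold for every translate of the kernel; for the lower bound
  one test function, evaluated at the single point 0, suffices.\<close>

lemma approx_between:
  assumes p: "1 \<le> p" and \<gamma>: "\<gamma> = \<beta> * pi / 2"
    and U: "\<And>\<phi> x. \<phi> \<in> Bp0 p \<Longrightarrow> \<bar>\<integral>t. \<phi> t * D (x - t) \<partial>circ\<bar> \<le> U"
    and L: "\<phi>0 \<in> Bp0 p" "L \<le> (\<integral>t. \<phi>0 (- t) * D t \<partial>circ)"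
  obtains v where "fourier_approx C_norm n (weyl_nagy_class r \<beta> p) = ereal v"
    "real n powr (-r) * (L / pi) \<le> v" "v \<le> real n powr (-r) * (U / pi)"
proof (rule ereal_real_of_ereal_between)
  let ?V = "fourier_approx C_norm n (weyl_nagy_class r \<beta> p)"
  show "?V \<le> ereal (real n powr (-r) * (U / pi))"
    unfolding fourier_approx_def
  proof (rule SUP_least)
    fix f assume "f \<in> weyl_nagy_class r \<beta> p"
    then obtain a0 \<phi> where \<phi>: "\<phi> \<in> Bp0 p"
      and f: "\<And>x. f x = a0 / 2 + 1 / pi * (LINT t:{-pi..pi}|lebesgue. \<phi> (x - t) * weyl_nagy_kernel r \<beta> t)"
      by (auto simp: weyl_nagy_class_def)
    note B = Bp0D[OF \<phi>]
    have \<phi>I: "integrable circ \<phi>" by (rule integrable_unit_ball[OF p B(1,3)])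
    show "C_norm (\<lambda>x. f x - fourier_sum (n - 1) f x) \<le> ereal (real n powr (-r) * (U / pi))"
      unfolding C_norm_def
    proof (rule SUP_least)
      fix x
      note Dx = continuous_D_reflect[of x]
      have Dp: "periodic_2pi (\<lambda>t. D (x - t))"
        unfolding periodic_2pi_def
      proof
        fix t
        have "D (x - (t + 2 * pi)) = D (x - (t + 2 * pi) + 2 * pi)"
          by (rule periodic_2piD[OF periodic_D, symmetric])
        then show "D (x - (t + 2 * pi)) = D (x - t)" by simp
      qed
      have "(\<integral>t. \<phi> (x - t) * D t \<partial>circ) = (\<integral>t. \<phi> (x - t) * D (x - (x - t)) \<partial>circ)" by simp
      also have "\<dots> = (\<integral>t. \<phi> t * D (x - t) \<partial>circ)"
      proof (rule integral_circ_reflect[where h = "\<lambda>t. \<phi> t * D (x - t)"])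
        show "(\<lambda>t. \<phi> t * D (x - t)) \<in> borel_measurable lebesgue"
          using B(1) continuous_measurable_lebesgue[OF Dx] by measurable
        show "periodic_2pi (\<lambda>t. \<phi> t * D (x - t))"
          using B(2) Dp by (simp add: periodic_2pi_def)
      qed (rule integrable_circ_mult[OF \<phi>I Dx])
      finally have "\<bar>\<integral>t. \<phi> (x - t) * D t \<partial>circ\<bar> \<le> U" using U[OF \<phi>] by simp
      then have "real n powr (-r) / pi * \<bar>\<integral>t. \<phi> (x - t) * D t \<partial>circ\<bar> \<le> real n powr (-r) / pi * U"
        by (intro mult_left_mono) auto
      then show "ereal \<bar>f x - fourier_sum (n - 1) f x\<bar> \<le> ereal (real n powr (-r) * (U / pi))"
        unfolding remainder_eq[OF p \<phi> \<gamma> f] abs_mult by simp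
    qed
  qed
  note B = Bp0D[OF L(1)]
  \<comment> \<open>The class member generated by \<open>\<phi>0\<close>, with constant term zero
    kept in the shape that \<open>remainder_eq\<close> expects.\<close>
  define f where "f = (\<lambda>x. 0 / 2 + 1 / pi * (LINT t:{-pi..pi}|lebesgue. \<phi>0 (x - t) * weyl_nagy_kernel r \<beta> t))"
  have f0: "f x = 0 / 2 + 1 / pi * (LINT t:{-pi..pi}|lebesgue. \<phi>0 (x - t) * weyl_nagy_kernel r \<beta> t)" for x
    by (simp add: f_def)
  have "periodic_2pi f"
  proof -
    have "\<phi>0 (x + 2 * pi - t) = \<phi>0 (x - t)" for x t
      using periodic_2piD[OF B(2), of "x - t"] by (simp add: algebra_simps)
    then show ?thesis by (simp add: periodic_2pi_def f_def)
  qed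
  then have fW: "f \<in> weyl_nagy_class r \<beta> p"
    unfolding weyl_nagy_class_def using L(1) f0 by blast
  have "real n powr (-r) / pi * L \<le> real n powr (-r) / pi * (\<integral>t. \<phi>0 (0 - t) * D t \<partial>circ)"
    using L(2) by (intro mult_left_mono) auto
  also have "\<dots> = f 0 - fourier_sum (n - 1) f 0"
    by (rule remainder_eq[OF p L(1) \<gamma> f0, symmetric])
  also have "\<dots> \<le> \<bar>f 0 - fourier_sum (n - 1) f 0\<bar>" by simp
  finally have "ereal (real n powr (-r) * (L / pi)) \<le> ereal \<bar>f 0 - fourier_sum (n - 1) f 0\<bar>"
    by simp
  also have "\<dots> \<le> C_norm (\<lambda>x. f x - fourier_sum (n - 1) f x)"
    unfolding C_norm_def by (rule SUP_upper) simp
  also have "\<dots> \<le> ?V"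
    unfolding fourier_approx_def by (rule SUP_upper[OF fW])
  finally show "ereal (real n powr (-r) * (L / pi)) \<le> ?V" .
qed (use that in blast)

text \<open>Two-sided bounds are rewritten in the O(1) form by solving for \<theta>; \<delta> is
  positive, so the division is legitimate.\<close>

lemma remainder_form:
  assumes "real n powr (-r) * ((T - c * \<delta>) / pi) \<le> v" "v \<le> real n powr (-r) * ((T + c * \<delta>) / pi)"
  shows "\<exists>\<theta>. \<bar>\<theta>\<bar> \<le> c / pi \<and> v = real n powr (-r) * (T / pi + \<theta> * (real n * r powr (-2)))"
proof (intro exI conjI)
  define w where "w = v / real n powr (-r)"
  define \<theta> where "\<theta> = (w - T / pi) / \<delta>"
  have n0: "0 < real n powr (-r)" using n by simp
  have v: "v = real n powr (-r) * w" using n0 by (simp add: w_def)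
  have "(T - c * \<delta>) / pi \<le> w" "w \<le> (T + c * \<delta>) / pi"
    using assms n0 unfolding v by (simp_all only: mult_le_cancel_left_pos)
  then have "\<bar>w - T / pi\<bar> \<le> c / pi * \<delta>"
    by (simp add: abs_le_iff diff_divide_distrib add_divide_distrib)
  then show "\<bar>\<theta>\<bar> \<le> c / pi" using \<delta>_pos by (simp add: \<theta>_def abs_divide divide_le_eq)
  have "real n * r powr (-2) = \<delta>" using r2 by (simp add: \<delta>_def powr_minus_divide)
  then show "v = real n powr (-r) * (T / pi + \<theta> * (real n * r powr (-2)))"
    using \<delta>_pos by (simp add: v \<theta>_def)
qed

lemma approx_finite_conjugate:
  assumes \<gamma>: "\<gamma> = \<beta> * pi / 2" and pq: "1 < p" "1 / p + 1 / ereal q = 1"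
  shows "\<exists>\<theta>. \<bar>\<theta>\<bar> \<le> 27 * pi + 512 \<and>
    fourier_approx C_norm n (weyl_nagy_class r \<beta> p) =
      ereal (real n powr (-r) * (circ_norm q cos * hypergeo_2F1 (q / 2) (q / 2) 1 (\<rho>\<^sup>2) powr (1 / q) / pi
        + \<theta> * (real n * r powr (-2))))"
proof -
  have p: "1 \<le> p" using pq by simp
  have q: "1 \<le> q" by (cases rule: conjugate_exponent_cases[OF pq]) auto
  define T where "T = circ_norm q cos * hypergeo_2F1 (q / 2) (q / 2) 1 (\<rho>\<^sup>2) powr (1 / q)"
  have T: "\<bar>circ_norm q D - T\<bar> \<le> (256 * pi + 18 * pi\<^sup>2) * \<delta>"
    unfolding T_def by (rule circ_norm_D[OF q])
  \<comment> \<open>The sum of 256 pi + 18 pi^2 from \<open>circ_norm_D\<close> and of 256 pi + 9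
    pi^2, which is half of the defect bound 2 pi (256 + 9 pi) in the mean-zero step.\<close>
  define c where "c = 512 * pi + 27 * pi\<^sup>2"
  have U: "\<bar>\<integral>t. \<phi> t * D (x - t) \<partial>circ\<bar> \<le> T + c * \<delta>" if "\<phi> \<in> Bp0 p" for \<phi> x
  proof -
    have "\<bar>\<integral>t. \<phi> t * D (x - t) \<partial>circ\<bar> \<le> circ_norm q (\<lambda>t. D (x - t))"
      by (rule holder_circ[OF pq Bp0D(1,3)[OF that] continuous_D_reflect])
    also have "\<dots> = circ_norm q D"
      using q by (intro circ_norm_shift continuous_D periodic_D) auto
    also have "\<dots> \<le> T + (256 * pi + 18 * pi\<^sup>2) * \<delta>" using T by linarith
    also have "\<dots> \<le> T + c * \<delta>"
      using \<delta>_pos by (intro add_left_mono mult_right_mono) (auto simp: c_def)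
    finally show ?thesis .
  qed
  obtain \<psi> where \<psi>: "\<psi> \<in> borel_measurable lebesgue" "periodic_2pi \<psi>" "Lp_norm p \<psi> \<le> 1"
    "(\<integral>t. \<psi> t * D t \<partial>circ) = circ_norm q D"
    by (rule exists_extremal[OF pq continuous_D periodic_D])
  obtain \<phi> where \<phi>: "\<phi> \<in> Bp0 p" "(\<integral>t. \<phi> (- t) * D t \<partial>circ) =
      (\<integral>t. \<psi> t * D t \<partial>circ) - (\<integral>t. \<psi> t * (D t + D (t - pi / real n)) \<partial>circ) / 2"
    by (rule exists_mean_zero[OF p \<psi>(1,2,3) continuous_D periodic_D])
  have cs: "continuous_on UNIV (\<lambda>t. D t + D (t - pi / real n))"
    by (intro continuous_on_add continuous_on_compose2[OF continuous_D] continuous_intros) auto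
  have "\<bar>\<integral>t. \<psi> t * (D t + D (t - pi / real n)) \<partial>circ\<bar> \<le> circ_norm q (\<lambda>t. D t + D (t - pi / real n))"
    by (rule holder_circ[OF pq \<psi>(1,3) cs])
  also have "\<dots> \<le> 2 * pi * ((256 + 9 * pi) * \<delta>)"
    by (rule circ_norm_le_sup[OF q cs D_half_shift])
  finally have L: "T - c * \<delta> \<le> (\<integral>t. \<phi> (- t) * D t \<partial>circ)"
    using T unfolding \<phi>(2) \<psi>(4) c_def by (simp add: algebra_simps abs_le_iff power2_eq_square)
  obtain v where v: "fourier_approx C_norm n (weyl_nagy_class r \<beta> p) = ereal v"
    "real n powr (-r) * ((T - c * \<delta>) / pi) \<le> v" "v \<le> real n powr (-r) * ((T + c * \<delta>) / pi)"
    by (rule approx_between[OF p \<gamma> U \<phi>(1) L]) auto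
  have "c / pi = 27 * pi + 512" by (simp add: c_def add_divide_distrib power2_eq_square)
  with remainder_form[OF v(2,3)] v(1) show ?thesis
    unfolding T_def[symmetric] by auto
qed

lemma approx_L1:
  assumes \<gamma>: "\<gamma> = \<beta> * pi / 2"
  shows "\<exists>\<theta>. \<bar>\<theta>\<bar> \<le> 27 * pi + 512 \<and>
    fourier_approx C_norm n (weyl_nagy_class r \<beta> 1) =
      ereal (real n powr (-r) * (1 / (pi * (1 - \<rho>)) + \<theta> * (real n * r powr (-2))))"
proof -
  define T where "T = 1 / (1 - \<rho>)"
  \<comment> \<open>A generous value, taken equal to the one for p > 1 so that a single constant
    serves both formulas.\<close>
  define c where "c = 512 * pi + 27 * pi\<^sup>2"
  have pi3: "3 < pi" by (rule pi_gt3)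
  then have pp: "9 * pi + 9 / 2 * pi \<le> 27 * pi\<^sup>2" by (simp add: power2_eq_square)
  have U: "\<bar>\<integral>t. \<phi> t * D (x - t) \<partial>circ\<bar> \<le> T + c * \<delta>" if "\<phi> \<in> Bp0 1" for \<phi> x
  proof -
    have "\<bar>\<integral>t. \<phi> t * D (x - t) \<partial>circ\<bar> \<le> T + 128 * \<delta>"
      unfolding T_def by (rule holder_circ_1[OF Bp0D(1,3)[OF that] continuous_D_reflect D_le])
    also have "\<dots> \<le> T + c * \<delta>"
      using \<delta>_pos pi3 pp by (intro add_left_mono mult_right_mono) (auto simp: c_def)
    finally show ?thesis .
  qed
  obtain t0 where "T - (129 + 9 * pi) * \<delta> < D t0" using D_large unfolding T_def by blast
  then obtain \<psi> where \<psi>: "\<psi> \<in> borel_measurable lebesgue" "periodic_2pi \<psi>" "Lp_norm 1 \<psi> \<le> 1"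
    "T - (129 + 9 * pi) * \<delta> \<le> (\<integral>t. \<psi> t * D t \<partial>circ)"
    by (rule exists_extremal_1[OF continuous_D periodic_D])
  obtain \<phi> where \<phi>: "\<phi> \<in> Bp0 1" "(\<integral>t. \<phi> (- t) * D t \<partial>circ) =
      (\<integral>t. \<psi> t * D t \<partial>circ) - (\<integral>t. \<psi> t * (D t + D (t - pi / real n)) \<partial>circ) / 2"
    by (rule exists_mean_zero[OF _ \<psi>(1,2,3) continuous_D periodic_D]) auto
  have cs: "continuous_on UNIV (\<lambda>t. D t + D (t - pi / real n))"
    by (intro continuous_on_add continuous_on_compose2[OF continuous_D] continuous_intros) auto
  have "\<bar>\<integral>t. \<psi> t * (D t + D (t - pi / real n)) \<partial>circ\<bar> \<le> (256 + 9 * pi) * \<delta>"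
    by (rule holder_circ_1[OF \<psi>(1,3) cs D_half_shift])
  then have "T - (257 + 9 * pi + 9 / 2 * pi) * \<delta> \<le> (\<integral>t. \<phi> (- t) * D t \<partial>circ)"
    using \<psi>(4) unfolding \<phi>(2) by (simp add: algebra_simps abs_le_iff)
  moreover have "(257 + 9 * pi + 9 / 2 * pi) * \<delta> \<le> c * \<delta>"
    using \<delta>_pos pi3 pp by (intro mult_right_mono) (auto simp: c_def)
  ultimately have L: "T - c * \<delta> \<le> (\<integral>t. \<phi> (- t) * D t \<partial>circ)" by linarith
  obtain v where v: "fourier_approx C_norm n (weyl_nagy_class r \<beta> 1) = ereal v"
    "real n powr (-r) * ((T - c * \<delta>) / pi) \<le> v" "v \<le> real n powr (-r) * ((T + c * \<delta>) / pi)"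
    by (rule approx_between[OF _ \<gamma> U \<phi>(1) L]) auto
  have "c / pi = 27 * pi + 512" by (simp add: c_def add_divide_distrib power2_eq_square)
  moreover have "T / pi = 1 / (pi * (1 - \<rho>))" by (simp add: T_def)
  ultimately show ?thesis
    using remainder_form[OF v(2,3)] v(1) by auto
qed

end

section \<open>The theorem for all exponents\<close>

lemma Lp_norm_cos:
  assumes q: "1 \<le> q"
  shows "real_of_ereal (Lp_norm (ereal q) cos) = circ_norm q cos"
proof -
  have c: "integrable circ (\<lambda>t. \<bar>cos t\<bar> powr q)"
    using q by (intro integrable_circ_abs_powr continuous_on_cos_real) auto
  have "(\<integral>\<^sup>+ t. ennreal (\<bar>cos t\<bar> powr q) \<partial>circ) = ennreal (\<integral>t. \<bar>cos t\<bar> powr q \<partial>circ)"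
    by (rule nn_integral_eq_integral[OF c]) simp
  then show ?thesis
    by (simp add: Lp_norm_def circ_norm_def integral_nonneg_AE)
qed

theorem theorem1:
  "\<exists>K::real. \<forall>(r::real) (\<beta>::real) (n::nat).
     n \<ge> 1 \<and> r > 1 \<and> sqrt (real n) + 1 \<le> r \<and> r \<le> real n + 1 \<longrightarrow>
       (\<exists>\<theta>::real. \<bar>\<theta>\<bar> \<le> K \<and>
          fourier_approx C_norm n (weyl_nagy_class r \<beta> 1) =
            ereal (real n powr (-r) *
              (1 / (pi * (1 - exp (- r / real n))) + \<theta> * (real n * r powr (-2)))))
     \<and> (\<forall>(p::ereal) (q::real). 1 < p \<and> 1 / p + 1 / ereal q = 1 \<longrightarrow>
          (\<exists>\<theta>::real. \<bar>\<theta>\<bar> \<le> K \<and>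
             fourier_approx C_norm n (weyl_nagy_class r \<beta> p) =
               ereal (real n powr (-r) *
                 (real_of_ereal (Lp_norm (ereal q) cos) / pi
                    * hypergeo_2F1 (q / 2) (q / 2) 1 (exp (- 2 * r / real n)) powr (1 / q)
                  + \<theta> * (real n * r powr (-2))))))"
proof (rule exI[of _ "27 * pi + 512"], intro allI impI conjI)
  fix r \<beta> :: real and n :: nat
  assume H: "n \<ge> 1 \<and> r > 1 \<and> sqrt (real n) + 1 \<le> r \<and> r \<le> real n + 1"
  then interpret parameters r "\<beta> * pi / 2" n by unfold_locales auto
  show "\<exists>\<theta>::real. \<bar>\<theta>\<bar> \<le> 27 * pi + 512 \<and>
          fourier_approx C_norm n (weyl_nagy_class r \<beta> 1) =
            ereal (real n powr (-r) *
              (1 / (pi * (1 - exp (- r / real n))) + \<theta> * (real n * r powr (-2))))"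
    using approx_L1 unfolding \<rho>_def by simp
  fix p :: ereal and q :: real
  assume pq: "1 < p \<and> 1 / p + 1 / ereal q = 1"
  have q: "1 \<le> q"
    by (cases rule: conjugate_exponent_cases[OF pq[THEN conjunct1] pq[THEN conjunct2]]) auto
  have "\<rho>\<^sup>2 = exp (- 2 * r / real n)"
    by (simp add: \<rho>_def power2_eq_square flip: exp_add)
  then show "\<exists>\<theta>::real. \<bar>\<theta>\<bar> \<le> 27 * pi + 512 \<and>
             fourier_approx C_norm n (weyl_nagy_class r \<beta> p) =
               ereal (real n powr (-r) *
                 (real_of_ereal (Lp_norm (ereal q) cos) / pi
                    * hypergeo_2F1 (q / 2) (q / 2) 1 (exp (- 2 * r / real n)) powr (1 / q)
                  + \<theta> * (real n * r powr (-2))))"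
    using approx_finite_conjugate[of \<beta> p q] pq by (simp add: Lp_norm_cos[OF q])
qed

end
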